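(* Let $s\ge1$ and let $Z$ have the PRR (Peköz–Röllin–Ross) density $$\kappa_s(x)=\Gamma(s)\sqrt{\frac{2}{s\pi}}\exp\Big(-\frac{x^2}{2s}\Big)U\Big(s-1,\frac12,\frac{x^2}{2s}\Big),\qquad x>0.$$ Let $n\ge1$, let $h\in C_b^{n-1}(\mathbb{R}_+)$, put $\tilde h(x)=h(x)-\mathbb{E}h(Z)$, and let $$f(x)=\frac1sV_s(x)\int_0^x\frac{1}{V_s(y)\kappa_s(y)}\int_0^y\tilde h(t)\kappa_s(t)\,dt\,dy,\qquad V_s(x)=U\Big(s-1,\frac12,\frac{x^2}{2s}\Big),$$ which solves the Stein equation $sf''(x)-xf'(x)-2(s-1)f(x)=\tilde h(x)$, $x>0$. Then $$\|f^{(n)}\|\le(n-1)!\sum_{j=0}^{n-1}\frac{(2\pi)^{(n-j)/2}}{j!}\|h^{(j)}\|.$$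
   Context: $U(a,b,x)$ denotes the confluent hypergeometric function of the second kind. $\|\cdot\|$ denotes the supremum norm on $\mathbb{R}_+=(0,\infty)$. $h\in C_b^n(\mathbb{R}_+)$ means that $h^{(n-1)}$ exists and is absolutely continuous, with derivatives of $h$ up to order $n$ bounded ($h$ itself included); for $n=0$, $h$ is bounded.
   Formalization: The Stein equation is asserted at every x>0 where h is continuous (all x>0 if n≥2); for n=1 and discontinuous h, f'' can fail to exist, e.g. h=1 on (0,1], 0 beyond, at x=1. For n=1, h is taken Borel measurable so that Eh(Z) and f are defined. *)

theory Defs
  imports "HOL-Probability.Probability"
begin

section \<open>Confluent hypergeometric functions\<close>

definition kummer_M :: "real \<Rightarrow> real \<Rightarrow> real \<Rightarrow> real" where
  "kummer_M a b z = (\<Sum>k. pochhammer a k / pochhammer b k * z ^ k / fact k)"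

text \<open>The formula of Abramowitz and Stegun, 13.1.3, for non-integral \<open>b\<close>, extended to integral
  \<open>b\<close> by its limit. With \<^const>\<open>rGamma\<close> in place of a quotient, the poles of the Gamma function
  contribute \<open>0\<close>; in particular \<open>U(0,b,z) = 1\<close> for non-integral \<open>b\<close>.\<close>

definition kummer_U_nonint :: "real \<Rightarrow> real \<Rightarrow> real \<Rightarrow> real" where
  "kummer_U_nonint a b z =
     pi / sin (pi * b) *
       (rGamma (1 + a - b) * rGamma b * kummer_M a b z
        - rGamma a * rGamma (2 - b) * z powr (1 - b) * kummer_M (1 + a - b) (2 - b) z)"

definition kummer_U :: "real \<Rightarrow> real \<Rightarrow> real \<Rightarrow> real" where
  "kummer_U a b z =
     (if b \<in> \<int> then Lim (at b) (\<lambda>c. kummer_U_nonint a c z) else kummer_U_nonint a b z)"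

definition PRR_V :: "real \<Rightarrow> real \<Rightarrow> real" where
  "PRR_V s x = kummer_U (s - 1) (1/2) (x\<^sup>2 / (2 * s))"

definition PRR_density :: "real \<Rightarrow> real \<Rightarrow> real" where
  "PRR_density s x =
     Gamma s * sqrt (2 / (s * pi)) * exp (- (x\<^sup>2 / (2 * s))) *
       kummer_U (s - 1) (1/2) (x\<^sup>2 / (2 * s))"

section \<open>Functions on the positive half-line\<close>

text \<open>A function on the positive half-line is represented by a total function; nothing below
  depends on its values on the non-positive reals.\<close>

abbreviation Rpos :: "real set" where
  "Rpos \<equiv> {0<..}"

text \<open>Existence of the \<open>k\<close>-th derivative at a point. Since \<^const>\<open>deriv\<close> is unspecified where
  the derivative does not exist, iterates of it are only meaningful together with this predicate.\<close>

primrec nderiv_exists :: "nat \<Rightarrow> (real \<Rightarrow> real) \<Rightarrow> real \<Rightarrow> bool" where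
  "nderiv_exists 0 g x \<longleftrightarrow> True"
| "nderiv_exists (Suc k) g x \<longleftrightarrow>
     (\<forall>\<^sub>F y in nhds x. nderiv_exists k g y) \<and> ((deriv ^^ k) g) differentiable (at x)"

text \<open>The supremum norm of the \<open>k\<close>-th derivative on the positive half-line. The top derivative of
  a function in \<open>C\<^sub>b\<^sup>k\<close> need only exist almost everywhere, so the supremum ranges over
  the points where it exists.\<close>

definition deriv_norm :: "nat \<Rightarrow> (real \<Rightarrow> real) \<Rightarrow> ennreal" where
  "deriv_norm k g =
     (SUP x\<in>{x \<in> Rpos. nderiv_exists k g x}. ennreal \<bar>(deriv ^^ k) g x\<bar>)"

definition abs_continuous_on :: "real set \<Rightarrow> (real \<Rightarrow> real) \<Rightarrow> bool" where
  "abs_continuous_on S g \<longleftrightarrow>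
     (\<forall>\<epsilon>>0. \<exists>\<delta>>0. \<forall>(N::nat) (a::nat \<Rightarrow> real) (b::nat \<Rightarrow> real).
        (\<forall>i<N. a i \<le> b i \<and> {a i..b i} \<subseteq> S) \<longrightarrow>
        disjoint_family_on (\<lambda>i. {a i<..<b i}) {..<N} \<longrightarrow>
        (\<Sum>i<N. b i - a i) < \<delta> \<longrightarrow>
        (\<Sum>i<N. \<bar>g (b i) - g (a i)\<bar>) < \<epsilon>)"

text \<open>The class \<open>C\<^sub>b\<^sup>m\<close> on the positive half-line. The almost-everywhere existence of
  the \<open>m\<close>-th derivative is a consequence of absolute continuity (Lebesgue), hence no restriction;
  it is spelled out because the boundedness of that derivative refers to it.\<close>

definition Cb :: "nat \<Rightarrow> (real \<Rightarrow> real) \<Rightarrow> bool" where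
  "Cb m g \<longleftrightarrow>
     (m > 0 \<longrightarrow>
        (\<forall>x\<in>Rpos. nderiv_exists (m - 1) g x) \<and>
        abs_continuous_on Rpos ((deriv ^^ (m - 1)) g) \<and>
        (AE x in lborel. x \<in> Rpos \<longrightarrow> nderiv_exists m g x)) \<and>
     (\<forall>j\<le>m. deriv_norm j g < \<infinity>)"

section \<open>The solution of the Stein equation\<close>

text \<open>The function \<open>f\<close> of the theorem for a right-hand side \<open>g\<close>, which is to be taken as
  \<open>g = h - E h(Z)\<close>.\<close>

definition stein_sol :: "real \<Rightarrow> (real \<Rightarrow> real) \<Rightarrow> real \<Rightarrow> real" where
  "stein_sol s g x =
     1 / s * PRR_V s x *
       (LBINT y:{0<..<x}. 1 / (PRR_V s y * PRR_density s y) *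
          (LBINT t:{0<..<y}. g t * PRR_density s t))"

end

(* Write kappa = A exp(-x^2/2s) V for the density and c = 2(s-1). The flux s A exp(-x^2/2s) V' has
   derivative c kappa and starts at -c, so, kappa having mass 1, it equals -c times the tail of kappa;
   in particular V is positive and decreasing, and the Mills ratio of kappa is at most sqrt(pi s/2).
   For n = 1 write f = V u / s. Then s f' = V' u + I/kappa, where I is the integral of h~ kappa, and if
   -a <= h~ <= b, both summands lie in intervals of length (a + b) times the Mills ratio. Here a + b
   may be taken to be 2 ||h||, which gives ||f'|| <= sqrt(2 pi) ||h||.
   For n >= 2 neither V nor kappa is needed: g = f^(n-1) is a bounded solution of
   s g'' - x g' - (c + n - 1) g = h^(n-1), and an energy estimate bounds g' by
   sqrt(2 pi) (||h^(n-1)|| + (n - 1) ||g||). Unfolding this recursion gives the claimed sum. *)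

theory Submission
  imports Defs
begin

section \<open>Kummer functions\<close>

text \<open>The obstacle for n >= 2 is that h^(n-1) exists only almost everywhere, so the equation
  for g = f^(n-1) cannot be used pointwise. It is used in integrated form, s g' = x g + d F + q,
  where F = f^(n-2), d = c + n - 2, and q is h^(n-2) (minus E h(Z) if n = 2), a Lipschitz function.
  The energy is then shown to be monotone by difference quotients instead of derivatives. The result
  s (g')^2 <= (d + 1) G^2 + 4 M G, with bounds G of g and M of h^(n-1), is weakened to the square of
  sqrt(2 pi) (M + (n - 1) G), the factor that the Mills ratio forces for n = 1. The sign of V is not
  read off from an integral representation of U. It has to come from the mass of kappa, but the law
  of Z fixes only the mass of the positive part of kappa. This still shows that V decreases, and a
  Gronwall argument then excludes a zero. For n = 1 the function h is merely bounded and measurable,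
  so f'' is claimed only where h is continuous.\<close>

definition kummer_coeff :: "real \<Rightarrow> real \<Rightarrow> nat \<Rightarrow> real" where
  "kummer_coeff a b k = pochhammer a k / (pochhammer b k * fact k)"

lemma kummer_M_coeff: "kummer_M a b z = (\<Sum>k. kummer_coeff a b k * z ^ k)"
  by (simp add: kummer_M_def kummer_coeff_def)

text \<open>In this multiplied-out form the recurrence says that the coefficient of z^k in Kummer's
  differential equation vanishes.\<close>

lemma kummer_coeff_Suc:
  assumes "b > 0"
  shows "(b + real k) * real (Suc k) * kummer_coeff a b (Suc k) = (a + real k) * kummer_coeff a b k"
proof -
  have "pochhammer b k \<noteq> 0" "b + real k \<noteq> 0"
    using assms by (auto simp: pochhammer_eq_0_iff)
  then have "(b + real k) * real (Suc k) * (P * (a + real k) / (pochhammer b k * (b + real k) * (real (Suc k) * fact k)))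
      = (a + real k) * (P / (pochhammer b k * fact k))" for P
    by (simp add: divide_simps del: of_nat_Suc)
  then show ?thesis
    by (simp add: kummer_coeff_def pochhammer_Suc del: of_nat_Suc)
qed

lemma summable_kummer:
  fixes z :: real
  assumes "b > 0"
  shows "summable (\<lambda>k. kummer_coeff a b k * z ^ k)"
proof -
  \<comment> \<open>\<open>C / (k + 1)\<close> bounds the ratio of consecutive terms, so the ratio
    is at most 1/2 as soon as \<open>k\<close> exceeds \<open>2 * C\<close>.\<close>
  define C where "C = (1 + \<bar>a\<bar> / b) * \<bar>z\<bar>"
  obtain N :: nat where N: "2 * C \<le> real N" using real_arch_simple by blast
  show ?thesis
  proof (rule summable_ratio_test[of "1/2" N])
    fix k assume "N \<le> k"
    then have k: "2 * C \<le> real (Suc k)" using N by linarith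
    have pos: "b + real k > 0" using assms by simp
    have "\<bar>a + real k\<bar> \<le> \<bar>a\<bar> + real k" by linarith
    also have "\<dots> \<le> (1 + \<bar>a\<bar> / b) * (b + real k)"
      using assms by (simp add: field_simps)
    finally have le: "\<bar>a + real k\<bar> / (b + real k) \<le> 1 + \<bar>a\<bar> / b"
      using pos by (simp add: field_simps)
    have "kummer_coeff a b (Suc k) = (a + real k) / ((b + real k) * real (Suc k)) * kummer_coeff a b k"
      using kummer_coeff_Suc[OF assms, of k a] pos
      by (simp add: nonzero_eq_divide_eq mult_ac del: of_nat_Suc)
    then have "norm (kummer_coeff a b (Suc k) * z ^ Suc k)
        = (\<bar>a + real k\<bar> / (b + real k)) * \<bar>z\<bar> / real (Suc k) * norm (kummer_coeff a b k * z ^ k)"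
      using pos by (simp add: abs_mult)
    also have "\<dots> \<le> 1/2 * norm (kummer_coeff a b k * z ^ k)"
    proof (rule mult_right_mono)
      have "(\<bar>a + real k\<bar> / (b + real k)) * \<bar>z\<bar> \<le> C"
        unfolding C_def by (rule mult_right_mono[OF le]) simp
      also have "\<dots> \<le> 1/2 * real (Suc k)" using k by simp
      finally show "(\<bar>a + real k\<bar> / (b + real k)) * \<bar>z\<bar> / real (Suc k) \<le> 1/2"
        by (subst pos_divide_le_eq) simp_all
    qed simp
    finally show "norm (kummer_coeff a b (Suc k) * z ^ Suc k) \<le> 1/2 * norm (kummer_coeff a b k * z ^ k)" .
  qed simp
qed

lemma kummer_M_0: "kummer_M a b 0 = 1"
proof -
  have "(\<lambda>k. kummer_coeff a b k * 0 ^ k) sums kummer_coeff a b 0"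
    by (rule powser_sums_zero)
  then show ?thesis by (simp add: kummer_M_coeff sums_iff kummer_coeff_def)
qed

lemma kummer_M_ode:
  assumes "b > 0"
  obtains M1 M2 where
    "\<And>z. (kummer_M a b has_real_derivative M1 z) (at z)"
    "\<And>z. (M1 has_real_derivative M2 z) (at z)"
    "\<And>z. z * M2 z + (b - z) * M1 z - a * kummer_M a b z = 0"
proof -
  define C where "C = kummer_coeff a b"
  have s0: "summable (\<lambda>k. C k * z ^ k)" for z
    unfolding C_def by (rule summable_kummer[OF assms])
  have s1: "summable (\<lambda>k. diffs C k * z ^ k)" for z
    by (rule termdiff_converges_all) (rule s0)
  have s2: "summable (\<lambda>k. diffs (diffs C) k * z ^ k)" for z
    by (rule termdiff_converges_all) (rule s1)
  define M1 where "M1 z = (\<Sum>k. diffs C k * z ^ k)" for z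
  define M2 where "M2 z = (\<Sum>k. diffs (diffs C) k * z ^ k)" for z
  have M: "kummer_M a b = (\<lambda>z. \<Sum>k. C k * z ^ k)"
    by (auto simp: C_def kummer_M_coeff)
  have d0: "(kummer_M a b has_real_derivative M1 z) (at z)" for z
    unfolding M M1_def by (rule termdiffs_strong_converges_everywhere) (rule s0)
  have d1: "(M1 has_real_derivative M2 z) (at z)" for z
    unfolding M1_def M2_def by (rule termdiffs_strong_converges_everywhere) (rule s1)
  have ode: "z * M2 z + (b - z) * M1 z - a * kummer_M a b z = 0" for z
  proof -
    have "(\<lambda>k. diffs C k * z ^ k) sums M1 z"
      unfolding M1_def by (rule summable_sums[OF s1])
    then have sM1: "(\<lambda>k. b * (diffs C k * z ^ k)) sums (b * M1 z)" by (rule sums_mult)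
    have sM: "(\<lambda>k. a * (C k * z ^ k)) sums (a * kummer_M a b z)"
      unfolding M by (intro sums_mult summable_sums s0)
    have "(\<lambda>k. z * (diffs (diffs C) k * z ^ k)) sums (z * M2 z)"
      unfolding M2_def by (intro sums_mult summable_sums s2)
    \<comment> \<open>The factor \<open>z\<close> shifts the index by one; the restored term for k =
      0 vanishes because of the factor \<open>real k\<close>. The same happens to
      \<open>z * M1 z\<close> below.\<close>
    then have "(\<lambda>k. real (Suc k) * diffs C (Suc k) * z ^ Suc k) sums (z * M2 z)"
      by (simp add: diffs_def mult_ac)
    then have sM2: "(\<lambda>k. real k * diffs C k * z ^ k) sums (z * M2 z)"
      by (subst (asm) sums_Suc_iff) simp
    have "(\<lambda>k. z * (diffs C k * z ^ k)) sums (z * M1 z)"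
      unfolding M1_def by (intro sums_mult summable_sums s1)
    then have "(\<lambda>k. real (Suc k) * C (Suc k) * z ^ Suc k) sums (z * M1 z)"
      by (simp add: diffs_def mult_ac)
    then have szM1: "(\<lambda>k. real k * C k * z ^ k) sums (z * M1 z)"
      by (subst (asm) sums_Suc_iff) simp
    have "(\<lambda>k. real k * diffs C k * z ^ k + b * (diffs C k * z ^ k) - real k * C k * z ^ k - a * (C k * z ^ k))
        sums (z * M2 z + b * M1 z - z * M1 z - a * kummer_M a b z)"
      by (intro sums_add sums_diff sM sM1 sM2 szM1)
    moreover have "real k * diffs C k * z ^ k + b * (diffs C k * z ^ k) - real k * C k * z ^ k - a * (C k * z ^ k) = 0" for k
    proof -
      have "real k * diffs C k * z ^ k + b * (diffs C k * z ^ k) - real k * C k * z ^ k - a * (C k * z ^ k)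
          = ((b + real k) * real (Suc k) * C (Suc k) - (a + real k) * C k) * z ^ k"
        by (simp add: diffs_def algebra_simps)
      then show ?thesis using kummer_coeff_Suc[OF assms, of k a] by (simp add: C_def)
    qed
    ultimately have "(\<lambda>k. 0::real) sums (z * M2 z + b * M1 z - z * M1 z - a * kummer_M a b z)" by simp
    then have "z * M2 z + b * M1 z - z * M1 z - a * kummer_M a b z = 0"
      using sums_unique2 sums_zero by blast
    then show ?thesis by (simp add: algebra_simps)
  qed
  show ?thesis using that d0 d1 ode by blast
qed

section \<open>The function V: differential equation and initial values\<close>

lemma half_not_Int: "(1/2::real) \<notin> \<int>"
proof
  assume "(1/2::real) \<in> \<int>"
  then obtain k where "(1/2::real) = of_int k" by (elim Ints_cases)
  then have "(1::real) = of_int (2 * k)" by simp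
  then have "1 = 2 * k" by linarith
  then show False by presburger
qed

lemma rGamma_half: "rGamma (1/2::real) = 1 / sqrt pi"
  by (simp add: rGamma_inverse_Gamma Gamma_one_half_real field_simps)

lemma rGamma_three_halves: "rGamma (3/2::real) = 2 / sqrt pi"
  using rGamma_plus1[of "1/2::real"] by (simp add: rGamma_half)

text \<open>For b = 1/2 the formula for U contains the root of x^2/(2s), so \<open>PRR_V s\<close>
  depends on the absolute value of x and may have a corner at 0. Writing
  \<open>x / sqrt (2 * s)\<close> for this root gives a smooth function \<open>W\<close> on the
  whole line, whose two-sided derivative at 0 supplies the initial value of the flux.\<close>

lemma PRR_V_ode:
  assumes "s \<ge> 1"
  obtains W W' where
    "\<And>x. x \<ge> 0 \<Longrightarrow> PRR_V s x = W x"
    "\<And>x. (W has_real_derivative W' x) (at x)"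
    "\<And>x. (W' has_real_derivative ((x * W' x + 2 * (s - 1) * W x) / s)) (at x)"
    "W 0 > 0"
    "Gamma s * sqrt (2 / (s * pi)) * s * W' 0 = - (2 * (s - 1))"
proof -
  define M where "M = kummer_M (s - 1) (1/2)"
  define N where "N = kummer_M (s - 1/2) (3/2)"
  obtain M1 M2 where M: "\<And>z. (M has_real_derivative M1 z) (at z)"
      "\<And>z. (M1 has_real_derivative M2 z) (at z)"
      "\<And>z. z * M2 z + (1/2 - z) * M1 z - (s - 1) * M z = 0"
    unfolding M_def using kummer_M_ode[of "1/2" "s - 1"] by auto
  obtain N1 N2 where N: "\<And>z. (N has_real_derivative N1 z) (at z)"
      "\<And>z. (N1 has_real_derivative N2 z) (at z)"
      "\<And>z. z * N2 z + (3/2 - z) * N1 z - (s - 1/2) * N z = 0"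
    unfolding N_def using kummer_M_ode[of "3/2" "s - 1/2"] by auto
  define z where "z x = x\<^sup>2 / (2 * s)" for x
  have s: "s > 0" using assms by simp
  have dz: "(z has_real_derivative x / s) (at x)" for x
    unfolding z_def using s by (auto intro!: derivative_eq_intros simp: field_simps)
  note dcomp = DERIV_chain2[OF _ dz]
  define \<alpha> where "\<alpha> = pi * rGamma (s - 1/2) * rGamma (1/2)"
  define \<beta> where "\<beta> = pi * rGamma (s - 1) * rGamma (3/2) / sqrt (2 * s)"
  define W where "W x = \<alpha> * M (z x) - \<beta> * (x * N (z x))" for x
  define W' where "W' x = \<alpha> * (M1 (z x) * (x / s)) - \<beta> * (N (z x) + 2 * z x * N1 (z x))" for x
  have eq: "PRR_V s x = W x" if "x \<ge> 0" for x
  proof -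
    have "(x\<^sup>2 / (2 * s)) powr (1/2) = x / sqrt (2 * s)"
      using that s by (simp add: powr_half_sqrt real_sqrt_divide)
    then show ?thesis
      using half_not_Int unfolding PRR_V_def kummer_U_def kummer_U_nonint_def W_def \<alpha>_def \<beta>_def M_def N_def z_def
      by (simp add: algebra_simps)
  qed
  have dM: "((\<lambda>x. M (z x)) has_real_derivative M1 (z x) * (x / s)) (at x)" for x
    by (rule dcomp) (rule M)
  have dM1: "((\<lambda>x. M1 (z x)) has_real_derivative M2 (z x) * (x / s)) (at x)" for x
    by (rule dcomp) (rule M)
  have dN: "((\<lambda>x. N (z x)) has_real_derivative N1 (z x) * (x / s)) (at x)" for x
    by (rule dcomp) (rule N)
  have dN1: "((\<lambda>x. N1 (z x)) has_real_derivative N2 (z x) * (x / s)) (at x)" for x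
    by (rule dcomp) (rule N)
  have dW: "(W has_real_derivative W' x) (at x)" for x
  proof -
    have "(W has_real_derivative \<alpha> * (M1 (z x) * (x / s)) - \<beta> * (1 * N (z x) + (N1 (z x) * (x / s)) * x)) (at x)"
      unfolding W_def by (intro DERIV_diff DERIV_cmult DERIV_mult DERIV_ident dM dN)
    moreover have "N1 (z x) * (x / s) * x = 2 * z x * N1 (z x)"
      using s by (simp add: z_def power2_eq_square field_simps)
    ultimately show ?thesis by (simp add: W'_def)
  qed
  have dW': "(W' has_real_derivative ((x * W' x + 2 * (s - 1) * W x) / s)) (at x)" for x
  proof -
    define m1 m2 n1 n2 m n where "m1 = M1 (z x)" and "m2 = M2 (z x)" and "n1 = N1 (z x)" and "n2 = N2 (z x)"
      and "m = M (z x)" and "n = N (z x)"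
    note defs = this
    define D where "D = \<alpha> * (m1 * (1 / s) + m2 * (x / s) * (x / s))
        - \<beta> * (n1 * (x / s) + (2 * z x * (n2 * (x / s)) + 2 * (x / s) * n1))"
    have "(W' has_real_derivative D) (at x)"
      unfolding W'_def D_def defs
      by (intro DERIV_diff DERIV_cmult DERIV_mult' DERIV_add DERIV_cdivide DERIV_ident dM1 dN1 dN dz)
    moreover have "D = (x * W' x + 2 * (s - 1) * W x) / s"
    proof -
      have "s * (m1 * (1 / s) + m2 * (x / s) * (x / s)) = 2 * z x * m2 + m1"
        using s by (simp add: z_def power2_eq_square field_simps)
      also have "\<dots> = 2 * z x * m1 + 2 * (s - 1) * m"
        using M(3)[of "z x"] unfolding defs by (simp add: algebra_simps)
      also have "\<dots> = x * (m1 * (x / s)) + 2 * (s - 1) * m"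
        using s by (simp add: z_def power2_eq_square field_simps)
      finally have 1: "s * (m1 * (1 / s) + m2 * (x / s) * (x / s)) = x * (m1 * (x / s)) + 2 * (s - 1) * m" .
      have "s * (n1 * (x / s) + (2 * z x * (n2 * (x / s)) + 2 * (x / s) * n1)) = x * (3 * n1 + 2 * (z x * n2))"
        using s by (simp add: field_simps)
      also have "3 * n1 + 2 * (z x * n2) = 2 * z x * n1 + (2 * s - 1) * n"
        using N(3)[of "z x"] unfolding defs by (simp add: algebra_simps)
      finally have 2: "s * (n1 * (x / s) + (2 * z x * (n2 * (x / s)) + 2 * (x / s) * n1))
          = x * (n + 2 * z x * n1) + 2 * (s - 1) * (x * n)" by (simp add: algebra_simps)
      have "s * D = \<alpha> * (s * (m1 * (1 / s) + m2 * (x / s) * (x / s)))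
          - \<beta> * (s * (n1 * (x / s) + (2 * z x * (n2 * (x / s)) + 2 * (x / s) * n1)))"
        unfolding D_def by (simp add: algebra_simps)
      also have "\<dots> = x * W' x + 2 * (s - 1) * W x"
        unfolding 1 2 by (simp add: W'_def W_def defs algebra_simps)
      finally show ?thesis using s by (simp add: field_simps)
    qed
    ultimately show ?thesis by simp
  qed
  have "W 0 = \<alpha>" by (simp add: W_def z_def M_def kummer_M_0)
  moreover have "\<alpha> > 0" unfolding \<alpha>_def
    using assms by (auto simp: rGamma_inverse_Gamma intro!: mult_pos_pos Gamma_real_pos)
  ultimately have W0: "W 0 > 0" by simp
  \<comment> \<open>With \<open>rGamma\<close> this includes s = 1, where both sides are 0.\<close>
  have "Gamma s * rGamma (s - 1) = s - 1"
    using rGamma_plus1[of "s - 1"] Gamma_real_pos[OF s]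
    by (simp add: rGamma_inverse_Gamma[of s] field_simps)
  note G = this
  have "Gamma s * sqrt (2 / (s * pi)) * s * W' 0
     = - (Gamma s * rGamma (s - 1)) * (sqrt (2 / (s * pi)) * s * pi * (2 / sqrt pi) / sqrt (2 * s))"
    by (simp add: W'_def z_def N_def kummer_M_0 \<beta>_def rGamma_three_halves mult_ac)
  also have "sqrt (2 / (s * pi)) * s * pi * (2 / sqrt pi) / sqrt (2 * s)
      = 2 * (s / (sqrt s * sqrt s)) * (pi / (sqrt pi * sqrt pi))"
    by (simp only: real_sqrt_divide real_sqrt_mult) (simp add: field_simps)
  also have "\<dots> = 2" using s by simp
  finally have "Gamma s * sqrt (2 / (s * pi)) * s * W' 0 = - (2 * (s - 1))" by (simp add: G)
  then show ?thesis using that eq dW dW' W0 by blast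
qed

section \<open>Absolutely continuous functions\<close>

text \<open>A Cousin partition subordinate to a gauge: at points of differentiability the increments are
  controlled by the derivative, and the cells tagged in the exceptional null set lie in an open
  set of small measure, where absolute continuity takes over.\<close>

lemma abs_continuous_on_imp_lipschitz:
  assumes ac: "abs_continuous_on Rpos g"
    and ae: "AE x in lborel. x \<in> Rpos \<longrightarrow> g differentiable (at x) \<and> \<bar>deriv g x\<bar> \<le> M"
    and M: "M \<ge> 0" and ab: "0 < a" "a \<le> b"
  shows "\<bar>g b - g a\<bar> \<le> M * (b - a)"
proof (rule field_le_epsilon)
  fix e' :: real assume "e' > 0"
  \<comment> \<open>The cells tagged outside the null set will cost \<open>e * (b - a)\<close>, the
    others \<open>e\<close>.\<close>
  define e where "e = e' / (b - a + 1)"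
  have e: "e > 0" and e': "e' = e * (b - a + 1)"
    using \<open>e' > 0\<close> ab by (auto simp: e_def add_pos_nonneg simp flip: add_divide_distrib distrib_left)
  obtain N where N: "N \<in> null_sets lborel"
    "{x \<in> space lborel. \<not> (x \<in> Rpos \<longrightarrow> g differentiable (at x) \<and> \<bar>deriv g x\<bar> \<le> M)} \<subseteq> N"
    using ae by (auto simp: eventually_ae_filter)
  obtain d where d: "d > 0" and
    AC: "\<And>(n::nat) u v. (\<forall>i<n. u i \<le> v i \<and> {u i..v i} \<subseteq> Rpos) \<Longrightarrow>
        disjoint_family_on (\<lambda>i. {u i<..<v i}) {..<n} \<Longrightarrow>
        (\<Sum>i<n. v i - u i) < d \<Longrightarrow> (\<Sum>i<n. \<bar>g (v i) - g (u i)\<bar>) < e"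
    using ac e unfolding abs_continuous_on_def by meson
  have NL: "N \<in> null_sets lebesgue" using N(1) null_sets_completionI by blast
  then obtain U where U: "open U" "N \<subseteq> U" "emeasure lebesgue (U - N) < ennreal d"
    by (meson sets_lebesgue_outer_open[OF _ d, of N] null_setsD2)
  have "emeasure lebesgue (U - N) = emeasure lebesgue U"
    using NL U(1) by (intro emeasure_Diff_null_set) auto
  with U have mU: "emeasure lborel U < ennreal d" by simp
  \<comment> \<open>The gauge: around a good point, a ball on which difference quotients are at most
    \<open>M + e\<close>; around a point of the null set, the open set \<open>U\<close>. Nonpositive
    points outside \<open>N\<close> never occur as tags.\<close>
  have "\<exists>S. open S \<and> x \<in> S \<and> (x \<in> N \<longrightarrow> S \<subseteq> U) \<and>
      (x \<notin> N \<longrightarrow> x > 0 \<longrightarrow> (\<forall>y\<in>S. \<bar>g y - g x\<bar> \<le> (M + e) * \<bar>y - x\<bar>))" for x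
  proof (cases "x \<notin> N \<and> x > 0")
    case True
    then have diff: "g differentiable (at x)" and le: "\<bar>deriv g x\<bar> \<le> M" using N(2) by auto
    then have "(g has_derivative (\<lambda>h. deriv g x * h)) (at x)"
      using DERIV_deriv_iff_real_differentiable has_field_derivative_def by blast
    then obtain r where r: "r > 0"
      "\<And>y. \<bar>y - x\<bar> < r \<Longrightarrow> \<bar>g y - g x - deriv g x * (y - x)\<bar> \<le> e * \<bar>y - x\<bar>"
      using e unfolding has_derivative_at_alt by (auto simp del: mult_le_cancel_right)
    have "\<bar>g y - g x\<bar> \<le> (M + e) * \<bar>y - x\<bar>" if "\<bar>y - x\<bar> < r" for y
    proof -
      have "\<bar>deriv g x * (y - x)\<bar> \<le> M * \<bar>y - x\<bar>"
        unfolding abs_mult by (rule mult_right_mono[OF le]) simp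
      then show ?thesis using r(2)[OF that] unfolding distrib_right by linarith
    qed
    with True r(1) show ?thesis
      by (intro exI[of _ "ball x r"]) (auto simp: dist_real_def abs_minus_commute)
  next
    case False
    then show ?thesis using U by (intro exI[of _ "if x \<in> N then U else UNIV"]) auto
  qed
  then obtain \<gamma> where \<gamma>: "\<And>x. open (\<gamma> x)" "\<And>x. x \<in> \<gamma> x" "\<And>x. x \<in> N \<Longrightarrow> \<gamma> x \<subseteq> U"
      "\<And>x y. x \<notin> N \<Longrightarrow> x > 0 \<Longrightarrow> y \<in> \<gamma> x \<Longrightarrow> \<bar>g y - g x\<bar> \<le> (M + e) * \<bar>y - x\<bar>"
    by metis
  have "gauge \<gamma>" using \<gamma>(1,2) by (auto simp: gauge_def)
  then obtain p where p: "p tagged_division_of cbox a b" "\<gamma> fine p"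
    using fine_division_exists by blast
  have pK: "K = {Inf K..Sup K} \<and> Inf K \<le> x \<and> x \<le> Sup K \<and> K \<subseteq> {a..b} \<and> K \<subseteq> \<gamma> x"
    if xK: "(x, K) \<in> p" for x K
  proof -
    obtain u v where "K = cbox u v" using tagged_division_ofD(4)[OF p(1) xK] by blast
    moreover have "x \<in> K" using tagged_division_ofD(2)[OF p(1) xK] .
    ultimately show ?thesis
      using tagged_division_ofD(3)[OF p(1) xK] fineD[OF p(2) xK] by auto
  qed
  have fin: "finite p" using p(1) by blast
  define p1 where "p1 = {(x, K) \<in> p. x \<in> N}"
  define G where "G = (\<lambda>(x::real, K). g (Sup K) - g (Inf K))"
  define L where "L = (\<lambda>(x::real, K::real set). Sup K - Inf K)"
  have p1: "p1 \<subseteq> p" "finite p1" using fin by (auto simp: p1_def intro: finite_subset[of _ p])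
  have "(\<Sum>z\<in>p. G z) = g b - g a"
    using additive_tagged_division_1[OF ab(2), of p g] p(1) by (simp add: G_def)
  then have "\<bar>g b - g a\<bar> \<le> (\<Sum>z\<in>p. \<bar>G z\<bar>)" by (metis sum_abs)
  also have "\<dots> = (\<Sum>z\<in>p - p1. \<bar>G z\<bar>) + (\<Sum>z\<in>p1. \<bar>G z\<bar>)"
    using sum.subset_diff[OF p1(1) fin] by blast
  also have "(\<Sum>z\<in>p - p1. \<bar>G z\<bar>) \<le> (M + e) * (b - a)"
  proof -
    have "(\<Sum>z\<in>p - p1. \<bar>G z\<bar>) \<le> (\<Sum>z\<in>p - p1. (M + e) * L z)"
    proof (rule sum_mono)
      fix z assume z: "z \<in> p - p1"
      obtain x K where zK: "z = (x, K)" by force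
      with z have xK: "(x, K) \<in> p" "x \<notin> N" by (auto simp: p1_def)
      note K = pK[OF xK(1)]
      have x: "x > 0" using K ab by force
      have in\<gamma>: "Inf K \<in> \<gamma> x" "Sup K \<in> \<gamma> x" using K by (metis atLeastAtMost_iff order.trans order_refl subsetD)+
      have "\<bar>g (Sup K) - g (Inf K)\<bar> \<le> \<bar>g (Sup K) - g x\<bar> + \<bar>g (Inf K) - g x\<bar>" by linarith
      also have "\<dots> \<le> (M + e) * \<bar>Sup K - x\<bar> + (M + e) * \<bar>Inf K - x\<bar>"
        by (intro add_mono \<gamma>(4) xK x in\<gamma>)
      also have "\<dots> = (M + e) * (Sup K - Inf K)" using K by (simp add: algebra_simps)
      finally show "\<bar>G z\<bar> \<le> (M + e) * L z" by (simp add: zK G_def L_def)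
    qed
    also have "\<dots> \<le> (\<Sum>z\<in>p. (M + e) * L z)"
      using fin M e by (intro sum_mono2) (auto simp: L_def intro!: mult_nonneg_nonneg dest!: pK)
    also have "\<dots> = (M + e) * (b - a)"
      using additive_tagged_division_1[OF ab(2), of p "\<lambda>x. x"] p(1)
      by (simp add: L_def flip: sum_distrib_left)
    finally show ?thesis .
  qed
  also have "(\<Sum>z\<in>p1. \<bar>G z\<bar>) < e"
  proof -
    \<comment> \<open>Absolute continuity speaks of indexed families, so the cells are numbered.
      Their interiors are disjoint and lie in \<open>U\<close>, hence their total length is below
      \<open>d\<close>.\<close>
    obtain \<phi> where \<phi>: "bij_betw \<phi> {..<card p1} p1"
      using ex_bij_betw_nat_finite[OF p1(2)] by (auto simp: atLeast0LessThan)
    define u where "u i = Inf (snd (\<phi> i))" for i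
    define v where "v i = Sup (snd (\<phi> i))" for i
    have in1: "\<phi> i \<in> p1" if "i < card p1" for i using \<phi> that by (auto simp: bij_betw_def)
    have in_p: "(fst (\<phi> i), snd (\<phi> i)) \<in> p" "fst (\<phi> i) \<in> N" if "i < card p1" for i
      using in1[OF that] by (auto simp: p1_def)
    have uv: "u i \<le> v i \<and> {u i..v i} \<subseteq> Rpos \<and> {u i..v i} \<subseteq> U" if "i < card p1" for i
    proof -
      note K = pK[OF in_p(1)[OF that]]
      moreover have "\<gamma> (fst (\<phi> i)) \<subseteq> U" by (rule \<gamma>(3)[OF in_p(2)[OF that]])
      ultimately show ?thesis unfolding u_def v_def using ab by fastforce
    qed
    have disj: "disjoint_family_on (\<lambda>i. {u i<..<v i}) {..<card p1}"
    proof (clarsimp simp only: disjoint_family_on_def lessThan_iff)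
      fix i j assume ij: "i < card p1" "j < card p1" "i \<noteq> j"
      have ne: "\<phi> i \<noteq> \<phi> j" using \<phi> ij by (auto simp: bij_betw_def inj_on_def)
      have int: "interior (snd (\<phi> i)) = {u i<..<v i}" if "i < card p1" for i
        using pK[OF in_p(1)[OF that]] unfolding u_def v_def by (metis interior_atLeastAtMost_real)
      have "interior (snd (\<phi> i)) \<inter> interior (snd (\<phi> j)) = {}"
        using tagged_division_ofD(5)[OF p(1) in_p(1)[OF ij(1)] in_p(1)[OF ij(2)]] ne by simp
      then show "{u i<..<v i} \<inter> {u j<..<v j} = {}" using int ij by simp
    qed
    have "ennreal (\<Sum>i<card p1. v i - u i) = (\<Sum>i<card p1. emeasure lborel {u i<..<v i})"
      using uv by (subst sum_ennreal[symmetric]) (auto intro!: sum.cong)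
    also have "\<dots> = emeasure lborel (\<Union>i<card p1. {u i<..<v i})"
      using disj by (intro sum_emeasure) auto
    also have "\<dots> \<le> emeasure lborel U"
      using uv U(1) by (intro emeasure_mono) (fastforce)+
    also have "\<dots> < ennreal d" by (rule mU)
    finally have "(\<Sum>i<card p1. v i - u i) < d" by (meson ennreal_leI not_less)
    then have "(\<Sum>i<card p1. \<bar>g (v i) - g (u i)\<bar>) < e"
      using AC[of "card p1" u v] uv disj by blast
    moreover have "(\<Sum>z\<in>p1. \<bar>G z\<bar>) = (\<Sum>i<card p1. \<bar>g (v i) - g (u i)\<bar>)"
      by (subst sum.reindex_bij_betw[OF \<phi>, symmetric]) (simp add: G_def u_def v_def split_beta)
    ultimately show ?thesis by simp
  qed
  finally show "\<bar>g b - g a\<bar> \<le> M * (b - a) + e'" by (simp add: e' algebra_simps)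
qed

section \<open>An energy estimate\<close>

lemma continuous_on_Rpos_of_increments:
  fixes q :: "real \<Rightarrow> real"
  assumes M: "M \<ge> 0"
    and q: "\<And>x y. 0 < x \<Longrightarrow> x \<le> y \<Longrightarrow> \<bar>q y - q x\<bar> \<le> M * (y - x)"
  shows "continuous_on Rpos q"
proof (rule lipschitz_on_continuous_on[OF lipschitz_onI[OF _ M]])
  fix x y assume "x \<in> Rpos" "y \<in> Rpos"
  then show "dist (q x) (q y) \<le> M * dist x y"
    using q[of x y] q[of y x] by (cases "x \<le> y") (auto simp: dist_real_def abs_minus_commute)
qed

text \<open>Energy argument: while \<open>p = g'\<close> is nonnegative, \<open>s p\<^sup>2 - (d + 1) g\<^sup>2 + 2 M g\<close> is
  nondecreasing, so a large value of \<open>p\<close> would persist and make \<open>g\<close> unbounded.\<close>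

lemma energy_bound_aux:
  fixes F g p q :: "real \<Rightarrow> real"
  assumes s: "s > 0" and d: "d \<ge> 0" and M: "M \<ge> 0"
    and F: "\<And>x. x > 0 \<Longrightarrow> (F has_real_derivative g x) (at x)"
    and g: "\<And>x. x > 0 \<Longrightarrow> (g has_real_derivative p x) (at x)"
    and p: "\<And>x. x > 0 \<Longrightarrow> s * p x = x * g x + d * F x + q x"
    and q: "\<And>x y. 0 < x \<Longrightarrow> x \<le> y \<Longrightarrow> \<bar>q y - q x\<bar> \<le> M * (y - x)"
    and G: "\<And>x. x > 0 \<Longrightarrow> \<bar>g x\<bar> \<le> G"
    and x0: "x0 > 0" "p x0 \<ge> 0"
  shows "s * (p x0)\<^sup>2 \<le> (d + 1) * G\<^sup>2 + 4 * M * G"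
proof (rule ccontr)
  define E where "E x = s * (p x)\<^sup>2 - (d + 1) * (g x)\<^sup>2 + 2 * M * g x" for x
  define r where "r x = x * g x + d * F x" for x
  have cg: "continuous_on Rpos g" and cF: "continuous_on Rpos F"
    using F g by (auto intro!: continuous_at_imp_continuous_on DERIV_isCont)
  have cq: "continuous_on Rpos q" by (rule continuous_on_Rpos_of_increments[OF M q])
  have cp: "continuous_on Rpos p"
  proof -
    have "continuous_on Rpos (\<lambda>x. (x * g x + d * F x + q x) / s)"
      using s by (intro continuous_intros cg cF cq) auto
    moreover have "(x * g x + d * F x + q x) / s = p x" if "x \<in> Rpos" for x
      using p[of x] s that by (simp add: field_simps)
    ultimately show ?thesis by (metis (lifting) continuous_on_cong)
  qed
  \<comment> \<open>A discrete form of E' >= 0: factor the difference of the squares of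
    \<open>p\<close>, and bound the increment of \<open>q\<close> from below by
    \<open>- M * (v - u)\<close>.\<close>
  have step: "E v - E u \<ge> (r v - r u - M * (v - u)) * (p v + p u)
      - (d + 1) * ((g v)\<^sup>2 - (g u)\<^sup>2) + 2 * M * (g v - g u)"
    if "0 < u" "u \<le> v" "p u \<ge> 0" "p v \<ge> 0" for u v
  proof -
    have "s * (p v - p u) = r v - r u + (q v - q u)"
      using p[of u] p[of v] that by (simp add: r_def algebra_simps)
    then have "r v - r u - M * (v - u) \<le> s * (p v - p u)"
      using q[of u v] that by linarith
    then have "(r v - r u - M * (v - u)) * (p v + p u) \<le> s * (p v - p u) * (p v + p u)"
      using that by (intro mult_right_mono) auto
    then show ?thesis unfolding E_def by (simp add: algebra_simps power2_eq_square)
  qed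
  \<comment> \<open>\<open>q\<close>, and with it \<open>E\<close>, may fail to be differentiable.
    It is enough that near each point increments of \<open>E\<close> are at least \<open>- e\<close>
    times the step; bisection extends this to the whole interval, and \<open>e\<close> is
    arbitrary.\<close>
  have mono: "E b \<ge> E a" if ab: "0 < a" "a \<le> b" and nonneg: "\<And>x. x \<in> {a..b} \<Longrightarrow> p x \<ge> 0" for a b
  proof (rule field_le_epsilon)
    fix e' :: real assume "e' > 0"
    define e where "e = e' / (b - a + 1)"
    have e: "e > 0" and e': "e' = e * (b - a + 1)"
      using \<open>e' > 0\<close> ab by (auto simp: e_def add_pos_nonneg)
    define P where "P u v \<longleftrightarrow> (a \<le> u \<longrightarrow> v \<le> b \<longrightarrow> E v \<ge> E u - e * (v - u))" for u v
    have "P a b" using ab(2)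
    proof (induction rule: Bolzano)
      case (trans u v w)
      then show ?case by (auto simp: P_def algebra_simps)
    next
      case (local x)
      \<comment> \<open>The lower bound of \<open>step\<close>, divided by the step length. As
        \<open>y\<close> tends to \<open>x\<close> the terms with \<open>d + 1\<close> and with
        \<open>M\<close> cancel and leave \<open>2 * x * (p x)\<^sup>2\<close>, which is
        nonnegative.\<close>
      define \<psi> where "\<psi> y = ((r y - r x) / (y - x) - M) * (p y + p x)
          - (d + 1) * (((g y)\<^sup>2 - (g x)\<^sup>2) / (y - x)) + 2 * M * ((g y - g x) / (y - x))" for y
      have x: "x > 0" using local ab by simp
      have dr: "(r has_real_derivative (1 * g x + p x * x + d * g x)) (at x)"
        unfolding r_def by (intro DERIV_add DERIV_mult DERIV_cmult DERIV_ident F g x)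
      have dg2: "((\<lambda>x. (g x)\<^sup>2) has_real_derivative 2 * g x * p x) (at x)"
        by (auto intro!: derivative_eq_intros g x)
      have "isCont p x" using cp x by (simp add: continuous_on_eq_continuous_at)
      then have "(\<psi> \<longlongrightarrow> (1 * g x + p x * x + d * g x - M) * (p x + p x)
          - (d + 1) * (2 * g x * p x) + 2 * M * p x) (at x)"
        unfolding \<psi>_def isCont_def using dr dg2 g[OF x]
        by (intro tendsto_intros) (simp_all add: DERIV_def has_field_derivative_iff)
      also have "(1 * g x + p x * x + d * g x - M) * (p x + p x) - (d + 1) * (2 * g x * p x) + 2 * M * p x
          = 2 * x * (p x)\<^sup>2"
        by (simp add: algebra_simps power2_eq_square)
      finally have "\<forall>\<^sub>F y in at x. - e < \<psi> y"
        using x e by (intro order_tendstoD(1)) (auto intro: less_le_trans[of _ 0])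
      then obtain \<delta> where \<delta>: "\<delta> > 0" "\<And>y. y \<noteq> x \<Longrightarrow> \<bar>y - x\<bar> < \<delta> \<Longrightarrow> - e < \<psi> y"
        by (auto simp: eventually_at dist_real_def)
      have low: "E v \<ge> E x - e * (v - x)" if "x \<le> v" "v \<le> b" "v - x < \<delta>" for v
      proof (cases "v = x")
        case False
        have "- e * (v - x) \<le> \<psi> v * (v - x)"
          using \<delta>(2)[of v] that False by (intro mult_right_mono) auto
        also have "\<psi> v * (v - x) = (r v - r x - M * (v - x)) * (p v + p x)
            - (d + 1) * ((g v)\<^sup>2 - (g x)\<^sup>2) + 2 * M * (g v - g x)"
        proof -
          have "\<psi> v * (v - x) = ((r v - r x) / (v - x) * (v - x) - M * (v - x)) * (p v + p x)
            - (d + 1) * (((g v)\<^sup>2 - (g x)\<^sup>2) / (v - x) * (v - x)) + 2 * M * ((g v - g x) / (v - x) * (v - x))"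
            unfolding \<psi>_def by (simp only: algebra_simps)
          then show ?thesis using False by simp
        qed
        also have "\<dots> \<le> E v - E x" using that local x by (intro step nonneg) auto
        finally show ?thesis by simp
      qed simp
      have high: "E x \<ge> E u - e * (x - u)" if "a \<le> u" "u \<le> x" "x - u < \<delta>" for u
      proof (cases "u = x")
        case False
        have "- e * (x - u) \<le> \<psi> u * (x - u)"
          using \<delta>(2)[of u] that False by (intro mult_right_mono) auto
        also have "\<psi> u * (x - u) = (r x - r u - M * (x - u)) * (p x + p u)
            - (d + 1) * ((g x)\<^sup>2 - (g u)\<^sup>2) + 2 * M * (g x - g u)"
        proof -
          have "\<psi> u * (u - x) = ((r u - r x) / (u - x) * (u - x) - M * (u - x)) * (p u + p x)
            - (d + 1) * (((g u)\<^sup>2 - (g x)\<^sup>2) / (u - x) * (u - x)) + 2 * M * ((g u - g x) / (u - x) * (u - x))"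
            unfolding \<psi>_def by (simp only: algebra_simps)
          then have "\<psi> u * (u - x) = (r u - r x - M * (u - x)) * (p u + p x)
            - (d + 1) * ((g u)\<^sup>2 - (g x)\<^sup>2) + 2 * M * (g u - g x)"
            using False by simp
          then show ?thesis by (simp add: algebra_simps)
        qed
        also have "\<dots> \<le> E x - E u" using that local ab by (intro step nonneg) auto
        finally show ?thesis by simp
      qed simp
      show ?case
      proof (intro exI[of _ \<delta>] conjI allI impI \<delta>(1))
        fix u v assume uv: "u \<le> x \<and> x \<le> v \<and> v - u < \<delta>"
        then show "P u v" unfolding P_def using low[of v] high[of u] by (auto simp: algebra_simps)
      qed
    qed
    then show "E a \<le> E b + e'" using e ab by (simp add: P_def e' algebra_simps)
  qed
  assume "\<not> s * (p x0)\<^sup>2 \<le> (d + 1) * G\<^sup>2 + 4 * M * G"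
  then obtain \<eta> where \<eta>: "\<eta> > 0" "s * (p x0)\<^sup>2 = (d + 1) * G\<^sup>2 + 4 * M * G + \<eta>"
    by (metis diff_gt_0_iff_gt linorder_not_le add_diff_cancel_left' add.commute diff_add_cancel)
  \<comment> \<open>This explains \<open>4 * M * G\<close>: the term \<open>2 * M * g\<close> of the
    energy can change by at most that much between \<open>x0\<close> and \<open>y\<close>. The
    excess \<open>\<eta>\<close> therefore survives.\<close>
  have persist: "s * (p y)\<^sup>2 \<ge> \<eta>" if y: "x0 \<le> y" and nonneg: "\<And>x. x \<in> {x0..y} \<Longrightarrow> p x \<ge> 0" for y
  proof -
    have "E y \<ge> E x0" using mono[OF x0(1) y nonneg] by blast
    moreover have "(g x0)\<^sup>2 \<le> G\<^sup>2" using G[OF x0(1)] by (simp add: abs_le_square_iff[symmetric])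
    then have "(d + 1) * (g x0)\<^sup>2 \<le> (d + 1) * G\<^sup>2" using d by (intro mult_left_mono) auto
    moreover have "(d + 1) * (g y)\<^sup>2 \<ge> 0" using d by simp
    moreover have "M * g y \<le> M * G" "M * - g x0 \<le> M * G"
      using G[of y] G[OF x0(1)] x0 y M by (intro mult_left_mono; simp)+
    ultimately show ?thesis using \<eta>(2) unfolding E_def by linarith
  qed
  \<comment> \<open>At a first zero of \<open>p\<close> the estimate \<open>persist\<close> would
    still apply and contradict \<open>p = 0\<close>.\<close>
  have pos: "p y > 0" if "x0 \<le> y" for y
  proof (rule ccontr)
    assume "\<not> p y > 0"
    define S where "S = {x \<in> {x0..y}. p x \<le> 0}"
    have "continuous_on {x0..y} p" using x0 by (intro continuous_on_subset[OF cp]) auto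
    then have "closed ({x0..y} \<inter> p -` {..0})"
      by (intro continuous_closed_preimage) auto
    moreover have "S = {x0..y} \<inter> p -` {..0}" by (auto simp: S_def)
    ultimately have "closed S" by simp
    moreover have "S \<noteq> {}" "bdd_below S" using \<open>\<not> p y > 0\<close> that by (auto simp: S_def)
    ultimately have in_S: "Inf S \<in> S" using closed_contains_Inf by blast
    have before: "p x > 0" if "x0 \<le> x" "x < Inf S" for x
      using that in_S cInf_lower[OF _ \<open>bdd_below S\<close>, of x] by (force simp: S_def)
    have "p (Inf S) \<ge> 0"
    proof (cases "Inf S = x0")
      case False
      then have lt: "x0 < Inf S" using in_S by (auto simp: S_def)
      have "(p \<longlongrightarrow> p (Inf S)) (at_left (Inf S))"
      proof (rule tendsto_within_subset)
        show "(p \<longlongrightarrow> p (Inf S)) (at (Inf S))"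
          using cp lt x0 by (simp add: continuous_on_eq_continuous_at isCont_def)
      qed simp
      then show ?thesis
        using lt before by (intro tendsto_lowerbound[of p _ "at_left (Inf S)"])
          (auto intro!: eventually_at_leftI[OF _ lt] less_imp_le)
    qed (use x0 in simp)
    moreover have "p (Inf S) \<le> 0" using in_S by (simp add: S_def)
    ultimately have "p (Inf S) = 0" by simp
    moreover have "s * (p (Inf S))\<^sup>2 \<ge> \<eta>"
      using in_S before \<open>p (Inf S) = 0\<close>
      by (intro persist) (auto simp: S_def less_eq_real_def)
    ultimately show False using \<eta>(1) by simp
  qed
  define \<epsilon> where "\<epsilon> = sqrt (\<eta> / s)"
  have \<epsilon>: "\<epsilon> > 0" using \<eta> s by (simp add: \<epsilon>_def)
  have low: "p y \<ge> \<epsilon>" if "x0 \<le> y" for y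
  proof -
    have "s * (p y)\<^sup>2 \<ge> \<eta>" using that pos by (intro persist) (auto intro: less_imp_le)
    then have "\<eta> / s \<le> (p y)\<^sup>2" using s by (simp add: field_simps)
    then show ?thesis unfolding \<epsilon>_def using pos[OF that] by (intro real_le_lsqrt) auto
  qed
  \<comment> \<open>Over this length a slope of at least \<open>\<epsilon>\<close> raises
    \<open>g\<close> by \<open>2 * G + 1\<close>, more than its range allows.\<close>
  define y where "y = x0 + (2 * G + 1) / \<epsilon>"
  have G0: "G \<ge> 0" using G[OF x0(1)] by simp
  have y: "x0 < y" using \<epsilon> G0 by (simp add: y_def add_pos_nonneg add_nonneg_pos)
  have "\<exists>z>x0. z < y \<and> g y - g x0 = (y - x0) * p z"
    using x0 g by (intro MVT2[OF y]) auto
  then obtain z where z: "x0 < z" "g y - g x0 = (y - x0) * p z" by blast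
  have "(y - x0) * p z \<ge> (y - x0) * \<epsilon>" using low[of z] z y by (intro mult_left_mono) auto
  also have "(y - x0) * \<epsilon> = 2 * G + 1" using \<epsilon> by (simp add: y_def)
  finally show False using z(2) G[OF x0(1)] G[of y] x0 y by linarith
qed

text \<open>The hypotheses are invariant under a common change of sign of \<open>F\<close>,
  \<open>g\<close>, \<open>p\<close> and \<open>q\<close>, which reduces negative \<open>p x\<close>
  to the previous lemma. In the application \<open>F\<close>, \<open>g\<close>, \<open>p\<close> are
  three consecutive derivatives of the solution.\<close>

lemma energy_bound:
  fixes F g p q :: "real \<Rightarrow> real"
  assumes s: "s > 0" and d: "d \<ge> 0" and M: "M \<ge> 0"
    and F: "\<And>x. x > 0 \<Longrightarrow> (F has_real_derivative g x) (at x)"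
    and g: "\<And>x. x > 0 \<Longrightarrow> (g has_real_derivative p x) (at x)"
    and p: "\<And>x. x > 0 \<Longrightarrow> s * p x = x * g x + d * F x + q x"
    and q: "\<And>x y. 0 < x \<Longrightarrow> x \<le> y \<Longrightarrow> \<bar>q y - q x\<bar> \<le> M * (y - x)"
    and G: "\<And>x. x > 0 \<Longrightarrow> \<bar>g x\<bar> \<le> G"
    and x: "x > 0"
  shows "s * (p x)\<^sup>2 \<le> (d + 1) * G\<^sup>2 + 4 * M * G"
proof (cases "p x \<ge> 0")
  case True
  show ?thesis by (rule energy_bound_aux[OF s d M F g p q G x True])
next
  case False
  have "s * (- p x)\<^sup>2 \<le> (d + 1) * G\<^sup>2 + 4 * M * G"
  proof (rule energy_bound_aux[OF s d M, of "\<lambda>x. - F x" "\<lambda>x. - g x" "\<lambda>x. - p x" "\<lambda>x. - q x"])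
    fix x y :: real assume "0 < x" "x \<le> y"
    then show "\<bar>- q y - - q x\<bar> \<le> M * (y - x)" using q[of x y] by linarith
  next
    fix x :: real assume "x > 0"
    then show "s * - p x = x * - g x + d * - F x + - q x" using p[of x] by simp
  qed (use F g G x False in \<open>auto intro: DERIV_minus\<close>)
  then show ?thesis by simp
qed

section \<open>The density and its Mills ratio\<close>

lemma half_gaussian_tail:
  assumes s: "s > (0::real)"
  shows "has_bochner_integral lborel (\<lambda>y. indicator {x..} y *\<^sub>R exp (- ((y - x)\<^sup>2 / (2 * s)))) (sqrt (pi * s / 2))"
proof -
  \<comment> \<open>The substitution (y - x)/r turns the integrand into the standard exp(-t^2) on
    the half-line.\<close>
  define r where "r = sqrt (2 * s)"
  have r: "r > 0" "r\<^sup>2 = 2 * s" using s by (auto simp: r_def)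
  have "has_bochner_integral lborel (\<lambda>y. indicator {0..} ((- x / r) + (1 / r) * y) *\<^sub>R exp (- ((- x / r) + (1 / r) * y)\<^sup>2))
      ((sqrt pi / 2) /\<^sub>R \<bar>1 / r\<bar>)"
    using gaussian_moment_0 r(1) by (subst (asm) lborel_has_bochner_integral_real_affine_iff[where c="1/r" and t="- x / r"]) auto
  moreover have "(sqrt pi / 2) /\<^sub>R \<bar>1 / r\<bar> = sqrt (pi * s / 2)"
  proof -
    have "(sqrt pi / 2) /\<^sub>R \<bar>1 / r\<bar> = sqrt pi * (sqrt 2 * sqrt s / 2)"
      using s by (simp add: r_def real_sqrt_mult)
    also have "sqrt 2 / 2 = 1 / sqrt (2::real)" by (simp add: field_simps)
    then have "sqrt 2 * sqrt s / 2 = sqrt s / sqrt 2" by (simp add: field_simps)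
    finally show ?thesis by (simp add: real_sqrt_mult real_sqrt_divide)
  qed
  moreover have "(- x / r) + (1 / r) * y = (y - x) / r" for y by (simp add: diff_divide_distrib)
  moreover have "((y - x) / r)\<^sup>2 = (y - x)\<^sup>2 / (2 * s)" for y by (simp add: power_divide r)
  moreover have "indicator {0..} ((y - x) / r) = (indicator {x..} y :: real)" for y
    using r(1) by (simp add: indicator_def zero_le_divide_iff)
  ultimately show ?thesis by simp
qed

lemma has_bochner_integral_mono:
  fixes f g :: "'a \<Rightarrow> real"
  assumes "has_bochner_integral M f a" "has_bochner_integral M g b" "\<And>x. f x \<le> g x"
  shows "a \<le> b"
  using assms integral_mono[of M f g] by (auto simp: has_bochner_integral_iff)

text \<open>No sign of \<open>W\<close> is assumed. Since \<open>ennreal\<close> cuts off negative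
  values, \<open>normalised\<close> only says that the positive part of the density has mass 1 on
  the half-line.\<close>

locale prr =
  fixes s c A :: real and W W' :: "real \<Rightarrow> real"
  assumes s_pos: "s > 0" and c_nonneg: "c \<ge> 0" and A_pos: "A > 0"
    and DW: "\<And>x. (W has_real_derivative W' x) (at x)"
    and DW': "\<And>x. (W' has_real_derivative ((x * W' x + c * W x) / s)) (at x)"
    and W_0: "W 0 > 0"
    and W'_0: "A * s * W' 0 = - c"
    and normalised: "(\<integral>\<^sup>+x. ennreal (indicator {0..} x * (A * exp (- (x\<^sup>2 / (2 * s))) * W x)) \<partial>lborel) = 1"
begin

definition dens :: "real \<Rightarrow> real" where
  "dens x = A * exp (- (x\<^sup>2 / (2 * s))) * W x"

text \<open>The equation \<open>s W'' = x W' + c W\<close> in self-adjoint form reads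
  \<open>flux' = c * dens\<close>; the exponential is its integrating factor.\<close>

definition flux :: "real \<Rightarrow> real" where
  "flux x = s * A * exp (- (x\<^sup>2 / (2 * s))) * W' x"

lemma D_gauss: "((\<lambda>x. exp (- (x\<^sup>2 / (2 * s)))) has_real_derivative - (x / s) * exp (- (x\<^sup>2 / (2 * s)))) (at x)"
  using s_pos by (auto intro!: derivative_eq_intros simp: field_simps)

lemma D_dens: "(dens has_real_derivative - (x / s) * dens x + A * exp (- (x\<^sup>2 / (2 * s))) * W' x) (at x)"
proof -
  have "(dens has_real_derivative
      A * (- (x / s) * exp (- (x\<^sup>2 / (2 * s)))) * W x + W' x * (A * exp (- (x\<^sup>2 / (2 * s))))) (at x)"
    unfolding dens_def by (intro DERIV_mult DERIV_cmult D_gauss DW)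
  then show ?thesis by (simp add: dens_def algebra_simps)
qed

lemma D_flux: "(flux has_real_derivative c * dens x) (at x)"
proof -
  have "(flux has_real_derivative s * A * (- (x / s) * exp (- (x\<^sup>2 / (2 * s)))) * W' x
      + (x * W' x + c * W x) / s * (s * A * exp (- (x\<^sup>2 / (2 * s))))) (at x)"
    unfolding flux_def by (intro DERIV_mult DERIV_cmult D_gauss DW')
  moreover have "s * A * (- (x / s) * e) * W' x + (x * W' x + c * W x) / s * (s * A * e) = c * (A * e * W x)" for e
    using s_pos by (simp add: field_simps)
  ultimately show ?thesis by (simp add: dens_def)
qed

lemma continuous_on_dens: "continuous_on S dens"
  using D_dens by (meson DERIV_isCont continuous_at_imp_continuous_on)

lemma continuous_on_W: "continuous_on S W"
  using DW by (meson DERIV_isCont continuous_at_imp_continuous_on)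

lemma borel_measurable_dens [measurable]: "dens \<in> borel_measurable borel"
  by (rule borel_measurable_continuous_onI[OF continuous_on_dens])

definition mass :: "real \<Rightarrow> real" where
  "mass x = integral {0..x} dens"

lemma flux_eq:
  assumes "x \<ge> 0"
  shows "flux x = - c * (1 - mass x)"
proof -
  have "((\<lambda>y. c * dens y) has_integral flux x - flux 0) {0..x}"
    using assms D_flux
    by (intro fundamental_theorem_of_calculus)
      (auto simp flip: has_real_derivative_iff_has_vector_derivative intro: DERIV_subset)
  then have "flux x - flux 0 = c * mass x"
    unfolding mass_def
    by (rule has_integral_unique)
      (intro has_integral_mult_right integrable_integral integrable_continuous_real continuous_on_dens)
  moreover have "flux 0 = - c" using W'_0 by (simp add: flux_def mult_ac)
  ultimately show ?thesis by (simp add: algebra_simps)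
qed

lemma normalised': "(\<integral>\<^sup>+x. ennreal (indicator {0..} x * dens x) \<partial>lborel) = 1"
  using normalised by (simp add: dens_def)

lemma nn_integral_dens_pos_part:
  "(\<integral>\<^sup>+y. ennreal (indicator {0..x} y * max 0 (dens y)) \<partial>lborel) = ennreal (integral {0..x} (\<lambda>y. max 0 (dens y)))"
  by (rule nn_integral_has_integral_lebesgue)
    (auto intro!: integrable_integral integrable_continuous_real continuous_intros continuous_on_dens)

text \<open>\<open>dens\<close> is not yet known to be positive, so the comparison passes through
  its positive part, whose total mass is 1.\<close>

lemma mass_le_1: "mass x \<le> 1"
proof -
  have "ennreal (integral {0..x} (\<lambda>y. max 0 (dens y))) \<le> (\<integral>\<^sup>+x. ennreal (indicator {0..} x * dens x) \<partial>lborel)"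
    unfolding nn_integral_dens_pos_part[symmetric]
    by (intro nn_integral_mono) (auto simp: indicator_def max_def ennreal_neg)
  then have "integral {0..x} (\<lambda>y. max 0 (dens y)) \<le> 1"
    unfolding normalised' by (simp add: ennreal_le_1)
  moreover have "mass x \<le> integral {0..x} (\<lambda>y. max 0 (dens y))" unfolding mass_def
    by (intro integral_le) (auto intro!: integrable_continuous_real continuous_intros continuous_on_dens)
  ultimately show ?thesis by linarith
qed

lemma W'_nonpos:
  assumes "x \<ge> 0"
  shows "W' x \<le> 0"
proof -
  have "flux x \<le> 0" unfolding flux_eq[OF assms] using mass_le_1 c_nonneg by (simp add: mult_nonneg_nonneg)
  then show ?thesis using s_pos A_pos by (simp add: flux_def mult_le_0_iff zero_less_mult_iff)
qed

lemma W_antimono: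
  assumes "0 \<le> x" "x \<le> y"
  shows "W y \<le> W x"
  using assms W'_nonpos DW by (intro DERIV_nonpos_imp_nonincreasing[OF assms(2)]) (meson order.trans)

text \<open>At a first zero \<open>z\<close> of \<open>W\<close> all the mass would lie in \<open>[0,z]\<close>, so that the flux at
  \<open>x < z\<close> is at most \<open>c\<close> times the mass of \<open>[x,z]\<close>. This gives \<open>-W' \<le> B W\<close>, and Gronwall's
  inequality excludes the zero.\<close>

lemma W_pos:
  assumes "x \<ge> 0"
  shows "W x > 0"
proof (rule ccontr)
  assume "\<not> W x > 0"
  then have "\<exists>z. 0 \<le> z \<and> z \<le> x \<and> W z = 0"
    using W_0 assms by (intro IVT2') (auto intro: continuous_on_W)
  then obtain z where z: "0 \<le> z" "W z = 0" by blast
  have after: "W y \<le> 0" if "y \<ge> z" for y using W_antimono[OF z(1) that] z(2) by simp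
  have before: "W y \<ge> 0" if "0 \<le> y" "y \<le> z" for y using W_antimono[OF that] z(2) by simp
  \<comment> \<open>By monotonicity \<open>W\<close> is nonpositive beyond \<open>z\<close>, where
    the truncated integrand therefore vanishes.\<close>
  have "(\<integral>\<^sup>+y. ennreal (indicator {0..} y * dens y) \<partial>lborel)
      = (\<integral>\<^sup>+y. ennreal (indicator {0..z} y * max 0 (dens y)) \<partial>lborel)"
  proof (intro nn_integral_cong)
    fix y
    show "ennreal (indicator {0..} y * dens y) = ennreal (indicator {0..z} y * max 0 (dens y))"
      using after[of y] before[of y] A_pos
      by (cases "y \<ge> z"; cases "y \<ge> 0")
        (auto simp: indicator_def dens_def ennreal_neg mult_nonneg_nonpos max_def mult_le_0_iff)
  qed
  also have "\<dots> = ennreal (integral {0..z} dens)"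
    unfolding nn_integral_dens_pos_part using before A_pos
    by (intro arg_cong[of _ _ ennreal] integral_cong) (auto simp: dens_def max_def mult_le_0_iff)
  finally have mass_z: "mass z = 1" unfolding normalised' mass_def by (simp add: ennreal_eq_1)
  \<comment> \<open>On the interval from \<open>y\<close> to \<open>z\<close> the density is at most
    \<open>A * W y\<close>, and the length is at most \<open>z\<close>. Dividing \<open>c\<close>
    times this mass by \<open>s * A * exp (- (y\<^sup>2 / (2 * s)))\<close> and replacing
    \<open>y\<close> by \<open>z\<close> in the exponential gives \<open>B * W y\<close>.\<close>
  define B where "B = c / s * exp (z\<^sup>2 / (2 * s)) * z"
  have ge: "W' y \<ge> - B * W y" if y: "0 \<le> y" "y \<le> z" for y
  proof -
    have "1 - mass y = integral {y..z} dens"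
      using Henstock_Kurzweil_Integration.integral_combine[OF y, of dens] mass_z
      by (simp add: mass_def integrable_continuous_real continuous_on_dens)
    also have "\<dots> \<le> integral {y..z} (\<lambda>_. A * W y)"
    proof (intro integral_le integrable_continuous_real continuous_on_dens continuous_on_const)
      fix t assume t: "t \<in> {y..z}"
      have "A * exp (- (t\<^sup>2 / (2 * s))) * W t \<le> A * 1 * W y"
        using t y A_pos s_pos W_antimono[of y t] before[of t]
        by (intro mult_mono mult_left_mono) auto
      then show "dens t \<le> A * W y" by (simp add: dens_def)
    qed
    also have "\<dots> = (z - y) * (A * W y)" using y by simp
    also have "\<dots> \<le> z * (A * W y)"
      using y A_pos before[OF y] by (intro mult_right_mono) auto
    finally have "c * (1 - mass y) \<le> c * (z * (A * W y))" using c_nonneg by (intro mult_left_mono)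
    then have "- flux y \<le> c * (z * (A * W y))" using flux_eq[OF y(1)] by simp
    then have "exp (y\<^sup>2 / (2 * s)) * - flux y \<le> exp (y\<^sup>2 / (2 * s)) * (c * (z * (A * W y)))"
      by (intro mult_left_mono) auto
    also have "\<dots> \<le> exp (z\<^sup>2 / (2 * s)) * (c * (z * (A * W y)))"
      using y s_pos c_nonneg A_pos z before[OF y]
      by (intro mult_right_mono mult_nonneg_nonneg) (auto intro!: divide_right_mono power_mono)
    also have "exp (y\<^sup>2 / (2 * s)) * - flux y = s * A * - W' y"
      by (simp add: flux_def exp_minus)
    also have "exp (z\<^sup>2 / (2 * s)) * (c * (z * (A * W y))) = s * A * (B * W y)"
      using s_pos by (simp add: B_def)
    finally have "- W' y \<le> B * W y"
      using s_pos A_pos by (subst (asm) mult_le_cancel_left_pos) auto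
    then show ?thesis by simp
  qed
  \<comment> \<open>Gronwall: \<open>exp (B * y) * W y\<close> cannot decrease, so it cannot fall
    from a positive value to 0 at \<open>z\<close>.\<close>
  have "exp (B * 0) * W 0 \<le> exp (B * z) * W z"
  proof (rule DERIV_nonneg_imp_nondecreasing[OF z(1)])
    fix y assume y: "0 \<le> y" "y \<le> z"
    have "((\<lambda>y. exp (B * y) * W y) has_real_derivative exp (B * y) * (W' y + B * W y)) (at y)"
      by (auto intro!: derivative_eq_intros DW simp: algebra_simps)
    moreover have "exp (B * y) * (W' y + B * W y) \<ge> 0" using ge[OF y] by simp
    ultimately show "\<exists>d. ((\<lambda>y. exp (B * y) * W y) has_real_derivative d) (at y) \<and> 0 \<le> d" by blast
  qed
  then show False using W_0 z by simp
qed

lemma dens_pos: "x \<ge> 0 \<Longrightarrow> dens x > 0"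
  using W_pos A_pos by (simp add: dens_def)

lemma W_nonzero: "x \<ge> 0 \<Longrightarrow> W x \<noteq> 0"
  using W_pos[of x] by simp

lemma dens_nonzero: "x \<ge> 0 \<Longrightarrow> dens x \<noteq> 0"
  using dens_pos[of x] by simp

lemma dens_integral: "has_bochner_integral lborel (\<lambda>x. indicator {0..} x * dens x) 1"
proof (rule has_bochner_integral_nn_integral)
  show "AE x in lborel. 0 \<le> indicator {0..} x * dens x"
    using dens_pos by (auto simp: indicator_def intro: less_imp_le)
qed (use normalised' in auto)

lemma mass_eq: 
  assumes "x \<ge> 0"
  shows "has_bochner_integral lborel (\<lambda>y. indicator {0..x} y * dens y) (mass x)"
proof -
  have "set_integrable lborel {0..x} dens"
    by (rule borel_integrable_atLeastAtMost') (rule continuous_on_dens)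
  then show ?thesis
    using set_borel_integral_eq_integral(2)[of "{0..x}" dens]
    by (simp add: mass_def set_integrable_def set_lebesgue_integral_def has_bochner_integral_iff)
qed

text \<open>Two facts combine: \<open>W\<close> decreases, and x^2 + (y - x)^2 <= y^2. This compares
  every tail of \<open>dens\<close> with a centred Gaussian tail started at 0.\<close>

lemma dens_decay:
  assumes "0 \<le> x" "x \<le> y"
  shows "dens y \<le> dens x * exp (- ((y - x)\<^sup>2 / (2 * s)))"
proof -
  have "x\<^sup>2 + (y - x)\<^sup>2 \<le> y\<^sup>2"
    using assms mult_left_mono[of x y x] by (simp add: power2_eq_square algebra_simps)
  then have "(x\<^sup>2 + (y - x)\<^sup>2) / (2 * s) \<le> y\<^sup>2 / (2 * s)"
    using s_pos by (intro divide_right_mono) auto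
  then have "exp (- (y\<^sup>2 / (2 * s))) \<le> exp (- (x\<^sup>2 / (2 * s))) * exp (- ((y - x)\<^sup>2 / (2 * s)))"
    by (simp add: add_divide_distrib flip: exp_add)
  then have "A * exp (- (y\<^sup>2 / (2 * s))) * W y
      \<le> A * (exp (- (x\<^sup>2 / (2 * s))) * exp (- ((y - x)\<^sup>2 / (2 * s)))) * W x"
    using assms A_pos W_antimono[OF assms] W_pos[of y] by (intro mult_mono mult_left_mono) auto
  then show ?thesis by (simp add: dens_def mult_ac)
qed

text \<open>The constant is the Mills ratio at \<open>0\<close> of the centred normal density of variance \<open>s\<close>.\<close>

lemma mills_bound:
  assumes "x \<ge> 0"
  shows "1 - mass x \<le> sqrt (pi * s / 2) * dens x"
proof -
  have "has_bochner_integral lborel (\<lambda>y. indicator {0..} y * dens y - indicator {0..x} y * dens y) (1 - mass x)"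
    by (intro has_bochner_integral_diff dens_integral mass_eq assms)
  moreover have "has_bochner_integral lborel (\<lambda>y. (indicator {x..} y *\<^sub>R exp (- ((y - x)\<^sup>2 / (2 * s)))) * dens x)
      (sqrt (pi * s / 2) * dens x)"
    by (intro has_bochner_integral_mult_left half_gaussian_tail s_pos)
  ultimately show ?thesis
  proof (rule has_bochner_integral_mono)
    fix y
    show "indicator {0..} y * dens y - indicator {0..x} y * dens y
        \<le> indicator {x..} y *\<^sub>R exp (- ((y - x)\<^sup>2 / (2 * s))) * dens x"
      using dens_decay[of x y] dens_pos[of x] assms
      by (cases "y < 0"; cases "y \<le> x"; cases "y = x") (auto simp: indicator_def mult.commute)
  qed
qed

end

section \<open>The solution and its first derivative\<close>

text \<open>The lower and upper bounds are kept apart because only their sum enters the estimate.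
  For h - mu with h bounded by H they are H + mu and H - mu, so mu cancels; a symmetric bound would
  cost the additional term 2 |mu|.\<close>

locale prr_stein = prr +
  fixes g :: "real \<Rightarrow> real" and a b :: real
  assumes g_measurable [measurable]: "g \<in> borel_measurable borel"
    and g_ge: "\<And>x. - a \<le> g x" and g_le: "\<And>x. g x \<le> b"
    and a_nonneg: "0 \<le> a" and b_nonneg: "0 \<le> b"
    and g_mean: "(LBINT x. indicator {0..} x * (g x * dens x)) = 0"
begin

lemma has_bochner_integral_g:
  "has_bochner_integral lborel (\<lambda>x. indicator {0..} x * (g x * dens x)) 0"
proof -
  have "integrable lborel (\<lambda>x. indicator {0..} x * (g x * dens x))"
  proof (rule Bochner_Integration.integrable_bound)
    show "integrable lborel (\<lambda>x. (a + b) * (indicator {0..} x * dens x))"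
      using dens_integral by (auto simp: has_bochner_integral_iff)
    have "\<bar>g x\<bar> \<le> a + b" for x using g_ge[of x] g_le[of x] a_nonneg b_nonneg by linarith
    then have "\<bar>g x\<bar> * \<bar>dens x\<bar> \<le> \<bar>a + b\<bar> * \<bar>dens x\<bar>" for x
      using a_nonneg b_nonneg by (intro mult_right_mono) auto
    then show "AE x in lborel. norm (indicator {0..} x * (g x * dens x)) \<le> norm ((a + b) * (indicator {0..} x * dens x))"
      by (auto simp: indicator_def abs_mult)
  qed measurable
  then show ?thesis using g_mean by (simp add: has_bochner_integral_iff)
qed

definition I :: "real \<Rightarrow> real" where
  "I x = integral {0..x} (\<lambda>t. g t * dens t)"

lemma set_integrable_g: "set_integrable lborel {0..x} (\<lambda>t. g t * dens t)"
proof -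
  have "integrable lborel (\<lambda>t. indicator {0..x} t *\<^sub>R (indicator {0..} t * (g t * dens t)))"
    using has_bochner_integral_g by (intro integrable_mult_indicator) (auto simp: has_bochner_integral_iff)
  also have "(\<lambda>t. indicator {0..x} t *\<^sub>R (indicator {0..} t * (g t * dens t)))
      = (\<lambda>t. indicator {0..x} t *\<^sub>R (g t * dens t))"
    by (auto simp: indicator_def)
  finally show ?thesis by (simp add: set_integrable_def)
qed

lemma g_integrable_on: "(\<lambda>t. g t * dens t) integrable_on {0..x}"
  using set_borel_integral_eq_integral(1)[OF set_integrable_g] .

lemma I_eq: "has_bochner_integral lborel (\<lambda>t. indicator {0..x} t * (g t * dens t)) (I x)"
  using set_integrable_g[of x] set_borel_integral_eq_integral(2)[OF set_integrable_g, of x]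
  by (simp add: I_def set_integrable_def set_lebesgue_integral_def has_bochner_integral_iff)

text \<open>The function \<open>(g + a) * dens\<close> is nonnegative, and its integral over the
  half-line is \<open>a\<close> because \<open>g\<close> has mean 0; the part over the interval from
  0 to \<open>x\<close> is at most that. \<open>I_ge\<close> does the same with
  \<open>(b - g) * dens\<close>.\<close>

lemma I_le:
  assumes "x \<ge> 0"
  shows "I x \<le> a * (1 - mass x)"
proof -
  have "I x + a * mass x \<le> 0 + a * 1"
  proof (rule has_bochner_integral_mono)
    show "has_bochner_integral lborel (\<lambda>t. indicator {0..x} t * (g t * dens t) + a * (indicator {0..x} t * dens t)) (I x + a * mass x)"
      by (intro has_bochner_integral_add has_bochner_integral_mult_right I_eq mass_eq assms)
    show "has_bochner_integral lborel (\<lambda>t. indicator {0..} t * (g t * dens t) + a * (indicator {0..} t * dens t)) (0 + a * 1)"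
      by (intro has_bochner_integral_add has_bochner_integral_mult_right has_bochner_integral_g dens_integral)
    have "0 \<le> (g t + a) * dens t" if "t \<ge> 0" for t
      using g_ge[of t] dens_pos[OF that] by (intro mult_nonneg_nonneg) auto
    then show "indicator {0..x} t * (g t * dens t) + a * (indicator {0..x} t * dens t)
        \<le> indicator {0..} t * (g t * dens t) + a * (indicator {0..} t * dens t)" for t
      by (auto simp: indicator_def distrib_right)
  qed
  then show ?thesis by (simp add: algebra_simps)
qed

lemma I_ge:
  assumes "x \<ge> 0"
  shows "- b * (1 - mass x) \<le> I x"
proof -
  have "b * mass x - I x \<le> b * 1 - 0"
  proof (rule has_bochner_integral_mono)
    show "has_bochner_integral lborel (\<lambda>t. b * (indicator {0..x} t * dens t) - indicator {0..x} t * (g t * dens t)) (b * mass x - I x)"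
      by (intro has_bochner_integral_diff has_bochner_integral_mult_right I_eq mass_eq assms)
    show "has_bochner_integral lborel (\<lambda>t. b * (indicator {0..} t * dens t) - indicator {0..} t * (g t * dens t)) (b * 1 - 0)"
      by (intro has_bochner_integral_diff has_bochner_integral_mult_right has_bochner_integral_g dens_integral)
    have "0 \<le> (b - g t) * dens t" if "t \<ge> 0" for t
      using g_le[of t] dens_pos[OF that] by (intro mult_nonneg_nonneg) auto
    then show "b * (indicator {0..x} t * dens t) - indicator {0..x} t * (g t * dens t)
        \<le> b * (indicator {0..} t * dens t) - indicator {0..} t * (g t * dens t)" for t
      by (auto simp: indicator_def left_diff_distrib)
  qed
  then show ?thesis by (simp add: algebra_simps)
qed

definition u :: "real \<Rightarrow> real" where
  "u x = integral {0..x} (\<lambda>y. I y / (W y * dens y))"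

lemma continuous_on_u_integrand: "continuous_on {0..x} (\<lambda>y. I y / (W y * dens y))"
proof (intro continuous_intros continuous_on_W continuous_on_dens ballI)
  show "continuous_on {0..x} I"
    unfolding I_def by (rule indefinite_integral_continuous_1[OF g_integrable_on])
qed (use W_nonzero dens_nonzero in auto)

lemma continuous_on_u: "continuous_on {0..x} u"
  unfolding u_def
  by (intro indefinite_integral_continuous_1 integrable_continuous_real continuous_on_u_integrand)

lemma at_within_Icc_0: "x > 0 \<Longrightarrow> at x within {0..x + 1} = at (x::real)"
  by (intro at_within_interior) auto

lemma D_u:
  assumes "x > 0"
  shows "(u has_real_derivative I x / (W x * dens x)) (at x)"
  using integral_has_real_derivative[OF continuous_on_u_integrand, of x "x + 1"] assms
  by (simp add: at_within_Icc_0 u_def[abs_def])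

text \<open>Continuity of \<open>g\<close> at the point enters here, and through
  \<open>D_sol'\<close> it becomes the condition under which the second derivative of the solution
  is obtained.\<close>

lemma D_I:
  assumes "x > 0" "isCont g x"
  shows "(I has_real_derivative g x * dens x) (at x)"
proof -
  have "isCont (\<lambda>t. g t * dens t) x"
    using assms D_dens by (intro continuous_intros) (auto intro: DERIV_isCont)
  then have "continuous (at x within ({0..x + 1} - {})) (\<lambda>t. g t * dens t)"
    by (simp add: continuous_at_imp_continuous_at_within)
  from integral_has_vector_derivative_continuous_at[OF g_integrable_on _ _ this]
  show ?thesis using assms
    by (simp add: at_within_Icc_0 has_real_derivative_iff_has_vector_derivative I_def[abs_def])
qed

text \<open>Since \<open>(1/W)' = c (1 - mass) / (s W dens)\<close>, the bounds on \<open>I\<close> integrate to bounds on \<open>c u\<close>.\<close>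

lemma D_inverse_W:
  assumes "x \<ge> 0"
  shows "((\<lambda>y. s / W y) has_real_derivative c * (1 - mass x) / (W x * dens x)) (at x)"
proof -
  have W: "W x > 0" by (rule W_pos[OF assms])
  have "((\<lambda>y. s / W y) has_real_derivative (0 * W x - s * W' x) / (W x * W x)) (at x)"
    using W by (intro DERIV_divide DERIV_const DW) auto
  moreover have "(0 * W x - s * W' x) / (W x * W x) = c * (1 - mass x) / (W x * dens x)"
  proof -
    have "c * (1 - mass x) = - flux x" using flux_eq[OF assms] by simp
    then show ?thesis using W A_pos by (simp add: flux_def dens_def)
  qed
  ultimately show ?thesis by simp
qed

lemma u_le:
  assumes x: "x \<ge> 0"
  shows "c * u x \<le> a * s / W x"
proof -
  \<comment> \<open>The value at 0 is nonnegative, since \<open>u 0 = 0\<close>, and is dropped at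
    the end.\<close>
  have "a * (s / W 0) - c * u 0 \<le> a * (s / W x) - c * u x"
  proof (rule DERIV_nonneg_imp_increasing_open[OF x])
    fix y assume y: "0 < y" "y < x"
    have "((\<lambda>y. a * (s / W y) - c * u y) has_real_derivative
        a * (c * (1 - mass y) / (W y * dens y)) - c * (I y / (W y * dens y))) (at y)"
      using y by (intro DERIV_diff DERIV_cmult D_inverse_W D_u) auto
    moreover have "a * (c * (1 - mass y) / (W y * dens y)) - c * (I y / (W y * dens y))
        = c * (a * (1 - mass y) - I y) / (W y * dens y)"
      by (simp add: diff_divide_distrib right_diff_distrib mult.left_commute)
    moreover have "\<dots> \<ge> 0"
      using I_le[of y] y c_nonneg W_pos[of y] dens_pos[of y] by simp
    ultimately show "\<exists>D. ((\<lambda>y. a * (s / W y) - c * u y) has_real_derivative D) (at y) \<and> 0 \<le> D"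
      by metis
  next
    show "continuous_on {0..x} (\<lambda>y. a * (s / W y) - c * u y)"
      using W_nonzero by (intro continuous_intros continuous_on_W continuous_on_u) auto
  qed
  moreover have "a * (s / W 0) \<ge> 0" using a_nonneg s_pos W_0 by simp
  moreover have "u 0 = 0" by (simp add: u_def)
  ultimately show ?thesis by simp
qed

lemma u_ge:
  assumes x: "x \<ge> 0"
  shows "- (b * s / W x) \<le> c * u x"
proof -
  have "b * (s / W 0) + c * u 0 \<le> b * (s / W x) + c * u x"
  proof (rule DERIV_nonneg_imp_increasing_open[OF x])
    fix y assume y: "0 < y" "y < x"
    have "((\<lambda>y. b * (s / W y) + c * u y) has_real_derivative
        b * (c * (1 - mass y) / (W y * dens y)) + c * (I y / (W y * dens y))) (at y)"
      using y by (intro DERIV_add DERIV_cmult D_inverse_W D_u) auto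
    moreover have "b * (c * (1 - mass y) / (W y * dens y)) + c * (I y / (W y * dens y))
        = c * (I y - (- b * (1 - mass y))) / (W y * dens y)"
      by (simp add: diff_divide_distrib add_divide_distrib algebra_simps)
    moreover have "\<dots> \<ge> 0"
      using I_ge[of y] y c_nonneg W_pos[of y] dens_pos[of y]
      by (intro divide_nonneg_nonneg mult_nonneg_nonneg) auto
    ultimately show "\<exists>D. ((\<lambda>y. b * (s / W y) + c * u y) has_real_derivative D) (at y) \<and> 0 \<le> D"
      by metis
  next
    show "continuous_on {0..x} (\<lambda>y. b * (s / W y) + c * u y)"
      using W_nonzero by (intro continuous_intros continuous_on_W continuous_on_u) auto
  qed
  moreover have "b * (s / W 0) \<ge> 0" using b_nonneg s_pos W_0 by simp
  moreover have "u 0 = 0" by (simp add: u_def)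
  ultimately show ?thesis by simp
qed

definition sol :: "real \<Rightarrow> real" where
  "sol x = 1 / s * (W x * u x)"

definition sol' :: "real \<Rightarrow> real" where
  "sol' x = 1 / s * (W' x * u x + I x / dens x)"

lemma D_sol:
  assumes "x > 0"
  shows "(sol has_real_derivative sol' x) (at x)"
proof -
  have "(sol has_real_derivative 1 / s * (W' x * u x + I x / (W x * dens x) * W x)) (at x)"
    unfolding sol_def by (intro DERIV_cmult DERIV_mult DW D_u assms)
  moreover have "I x / (W x * dens x) * W x = I x / dens x" using W_pos[of x] assms by simp
  ultimately show ?thesis by (simp add: sol'_def)
qed

text \<open>With the Mills ratio R, the term \<open>W' x * u x\<close> lies between -aR and bR
  because \<open>W'\<close> is nonpositive, whereas \<open>I x / dens x\<close> lies between -bR and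
  aR. The roles of a and b are exchanged, so both extremes of the sum have absolute value (a + b)
  R.\<close>

lemma sol'_bound:
  assumes x: "x \<ge> 0"
  shows "\<bar>sol' x\<bar> \<le> (a + b) * sqrt (pi / (2 * s))"
proof -
  define R where "R = (1 - mass x) / dens x"
  have d: "dens x > 0" and W: "W x > 0" using x by (auto intro: dens_pos W_pos)
  have R0: "R \<ge> 0" using d mass_le_1 by (simp add: R_def)
  have R: "R \<le> sqrt (pi * s / 2)"
    using mills_bound[OF x] d by (simp add: R_def pos_divide_le_eq)
  have I: "- b * R \<le> I x / dens x" "I x / dens x \<le> a * R"
    using I_le[OF x] I_ge[OF x] d by (auto simp: R_def divide_right_mono pos_le_divide_eq pos_divide_le_eq)
  have Wu: "W' x * u x = - (R * (c * u x * W x / s))"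
  proof -
    have "W' x * (s * dens x) = flux x * W x" by (simp add: flux_def dens_def)
    also have "\<dots> = - c * (R * dens x) * W x" using flux_eq[OF x] d by (simp add: R_def)
    finally have "(W' x * s) * dens x = (- c * R * W x) * dens x" by (simp add: mult_ac)
    then have "W' x * s = - c * R * W x" using d by (subst (asm) mult_right_cancel) auto
    then have "W' x = - c * R * W x / s" using s_pos by (simp add: field_simps)
    then show ?thesis by (simp add: mult_ac)
  qed
  have "c * u x * W x / s \<le> a" "- b \<le> c * u x * W x / s"
    using u_le[OF x] u_ge[OF x] W s_pos by (simp_all add: field_simps)
  then have "R * (c * u x * W x / s) \<le> R * a" "R * (- b) \<le> R * (c * u x * W x / s)"
    using R0 by (intro mult_left_mono; simp)+
  then have "\<bar>W' x * u x + I x / dens x\<bar> \<le> (a + b) * R"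
    using I unfolding Wu by (simp add: abs_le_iff algebra_simps)
  also have "\<dots> \<le> (a + b) * sqrt (pi * s / 2)"
    using R a_nonneg b_nonneg by (intro mult_left_mono) auto
  finally have "\<bar>sol' x\<bar> \<le> 1 / s * ((a + b) * sqrt (pi * s / 2))"
    unfolding sol'_def abs_mult using s_pos by (simp add: divide_right_mono)
  also have "1 / s * sqrt (pi * s / 2) = sqrt (pi / (2 * s))"
    using s_pos by (simp add: real_sqrt_divide real_sqrt_mult field_simps)
  then have "1 / s * ((a + b) * sqrt (pi * s / 2)) = (a + b) * sqrt (pi / (2 * s))" by (simp add: mult_ac)
  finally show ?thesis .
qed

lemma D_sol':
  assumes x: "x > 0" and "isCont g x"
  shows "(sol' has_real_derivative (x * sol' x + c * sol x + g x) / s) (at x)"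
proof -
  define d where "d = dens x"
  have d: "d > 0" and W: "W x > 0" using x by (auto simp: d_def intro: dens_pos W_pos)
  define d' where "d' = - (x / s) * d + A * exp (- (x\<^sup>2 / (2 * s))) * W' x"
  have d': "d' = - (x / s) * d + d * W' x / W x" using W by (simp add: d'_def d_def dens_def)
  have "(sol' has_real_derivative 1 / s * (((x * W' x + c * W x) / s * u x + I x / (W x * d) * W' x)
      + (g x * d * d - I x * d') / (d * d))) (at x)"
    unfolding sol'_def d_def d'_def using d
    by (intro DERIV_cmult DERIV_add DERIV_mult DERIV_divide DW' D_u D_I D_dens assms) (simp add: d_def)
  \<comment> \<open>The last term cancels the cross term from the derivative of \<open>u\<close>,
    and the term \<open>x * I x / (s * d)\<close> is the part of \<open>x * sol' x\<close> that
    comes from \<open>I / dens\<close>.\<close>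
  moreover have "(g x * d * d - I x * d') / (d * d) = g x + x * I x / (s * d) - I x * W' x / (W x * d)"
    using d W s_pos unfolding d' by (simp add: field_simps)
  moreover have "1 / s * (((x * W' x + c * W x) / s * u x + I x / (W x * d) * W' x)
      + (g x + x * I x / (s * d) - I x * W' x / (W x * d)))
      = (x * (1 / s * (W' x * u x + I x / d)) + c * (1 / s * (W x * u x)) + g x) / s"
    by (simp add: add_divide_distrib diff_divide_distrib algebra_simps)
  ultimately have "(sol' has_real_derivative
      (x * (1 / s * (W' x * u x + I x / d)) + c * (1 / s * (W x * u x)) + g x) / s) (at x)" by (simp only:)
  then show ?thesis by (simp only: sol_def sol'_def[of x] d_def)
qed

end

section \<open>Higher derivatives\<close>

lemma nderiv_exists_mono:
  assumes "nderiv_exists n g x" "k \<le> n"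
  shows "nderiv_exists k g x"
  using assms(2,1)
proof (induction n)
  case (Suc n)
  then show ?case by (cases "k = Suc n") (auto dest: eventually_nhds_x_imp_x)
qed simp

lemma nderiv_exists_SucI:
  assumes "\<And>x. x > 0 \<Longrightarrow> nderiv_exists k g x" "x > 0" "(deriv ^^ k) g differentiable (at x)"
  shows "nderiv_exists (Suc k) g x"
  using assms eventually_nhds_in_open[of Rpos x] by (auto elim!: eventually_mono)

lemma nderiv_exists_DERIV:
  assumes "nderiv_exists (Suc k) g x"
  shows "((deriv ^^ k) g has_real_derivative (deriv ^^ Suc k) g x) (at x)"
  using assms by (simp add: DERIV_deriv_iff_real_differentiable)

text \<open>Derivatives at a positive point are local and the half-line is open, so agreement with
  an explicit family there carries over to the iterates of \<open>deriv\<close>.\<close>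

lemma nderiv_chain:
  assumes D0: "\<And>x. x > 0 \<Longrightarrow> g x = D 0 x"
    and D: "\<And>k x. k < n \<Longrightarrow> x > 0 \<Longrightarrow> (D k has_real_derivative D (Suc k) x) (at x)"
    and "k \<le> n" "x > 0"
  shows "nderiv_exists k g x \<and> (deriv ^^ k) g x = D k x"
  using assms(3,4)
proof (induction k arbitrary: x)
  case 0
  then show ?case using D0 by simp
next
  case (Suc k)
  have "((deriv ^^ k) g has_real_derivative D (Suc k) x) (at x)"
  proof (rule has_field_derivative_transform_within_open[OF _ open_greaterThan[of 0]])
    show "(D k has_real_derivative D (Suc k) x) (at x)" using D Suc.prems by simp
  qed (use Suc in auto)
  moreover from this have "nderiv_exists (Suc k) g x"
    using Suc by (intro nderiv_exists_SucI) (auto simp: real_differentiable_def)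
  ultimately show ?case by (simp add: DERIV_imp_deriv)
qed

lemma abs_nderiv_le_deriv_norm:
  assumes "deriv_norm k g < \<infinity>" "x > 0" "nderiv_exists k g x"
  shows "\<bar>(deriv ^^ k) g x\<bar> \<le> enn2real (deriv_norm k g)"
proof -
  have "ennreal \<bar>(deriv ^^ k) g x\<bar> \<le> deriv_norm k g"
    unfolding deriv_norm_def using assms by (intro SUP_upper) auto
  then have "enn2real (ennreal \<bar>(deriv ^^ k) g x\<bar>) \<le> enn2real (deriv_norm k g)"
    using assms by (intro enn2real_mono) auto
  then show ?thesis by simp
qed

text \<open>Below the top order the derivative exists everywhere and the mean value theorem applies.
  At the top order it exists only almost everywhere, and absolute continuity replaces that
  theorem.\<close>

lemma Cb_nderiv_lipschitz:
  assumes h: "Cb m h" and k: "k < m" and xy: "0 < x" "x \<le> y"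
  shows "\<bar>(deriv ^^ k) h y - (deriv ^^ k) h x\<bar> \<le> enn2real (deriv_norm (Suc k) h) * (y - x)"
proof -
  have fin: "deriv_norm (Suc k) h < \<infinity>" using h k by (auto simp: Cb_def)
  have bound: "\<bar>(deriv ^^ Suc k) h t\<bar> \<le> enn2real (deriv_norm (Suc k) h)"
    if "nderiv_exists (Suc k) h t" "t > 0" for t
    using abs_nderiv_le_deriv_norm[OF fin] that by blast
  show ?thesis
  proof (cases "Suc k = m")
    case True
    have ae: "AE t in lborel. t \<in> Rpos \<longrightarrow> nderiv_exists (Suc k) h t"
      using h True by (auto simp: Cb_def)
    show ?thesis
    proof (rule abs_continuous_on_imp_lipschitz)
      show "abs_continuous_on Rpos ((deriv ^^ k) h)" using h True by (auto simp: Cb_def)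
      show "AE t in lborel. t \<in> Rpos \<longrightarrow> (deriv ^^ k) h differentiable at t \<and>
          \<bar>deriv ((deriv ^^ k) h) t\<bar> \<le> enn2real (deriv_norm (Suc k) h)"
        using ae by eventually_elim (use bound in auto)
    qed (use xy in auto)
  next
    case False
    have ex: "nderiv_exists (Suc k) h t" if "t > 0" for t
    proof (rule nderiv_exists_mono)
      show "nderiv_exists (m - 1) h t" using h k that unfolding Cb_def by simp
      show "Suc k \<le> m - 1" using k False by simp
    qed
    show ?thesis
    proof (cases "x = y")
      case False
      then have "x < y" using xy by simp
      then have "\<exists>z>x. z < y \<and> (deriv ^^ k) h y - (deriv ^^ k) h x = (y - x) * (deriv ^^ Suc k) h z"
        using xy by (intro MVT2 nderiv_exists_DERIV ex) linarith+
      then obtain z where z: "x < z" "(deriv ^^ k) h y - (deriv ^^ k) h x = (y - x) * (deriv ^^ Suc k) h z"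
        by blast
      have "\<bar>(deriv ^^ k) h y - (deriv ^^ k) h x\<bar> = \<bar>(deriv ^^ Suc k) h z\<bar> * (y - x)"
        unfolding z(2) abs_mult using xy by (simp only: abs_of_nonneg mult.commute diff_ge_0_iff_ge)
      also have "\<dots> \<le> enn2real (deriv_norm (Suc k) h) * (y - x)"
        using xy z(1) by (intro mult_right_mono bound ex) linarith+
      finally show ?thesis .
    qed simp
  qed
qed

section \<open>The recursion for the bounds and its solution\<close>

lemma deriv_bound_step:
  fixes s p G M :: real and j :: nat
  assumes s: "s \<ge> 1" and j: "j \<ge> 1" and G: "G \<ge> 0" and M: "M \<ge> 0"
    and p: "s * p\<^sup>2 \<le> (2 * (s - 1) + real (j - 1) + 1) * G\<^sup>2 + 4 * M * G"
  shows "\<bar>p\<bar> \<le> sqrt (2 * pi) * (M + real j * G)"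
proof -
  have pi: "pi \<ge> 2" using pi_gt3 by simp
  have j1: "real j \<ge> 1" using j by simp
  \<comment> \<open>The two terms of the energy bound are matched with the square and the mixed term
    of pi s (M + j G)^2. The factor 2 pi s on the right-hand side leaves room to spare.\<close>
  have "2 * (s - 1) + real (j - 1) + 1 \<le> 2 * s * real j"
  proof -
    have "0 \<le> (2 * s - 1) * (real j - 1)" using s j1 by (intro mult_nonneg_nonneg) auto
    then show ?thesis using j s by (simp add: of_nat_diff algebra_simps)
  qed
  also have "\<dots> \<le> 2 * s * real j * real j" using s j1 mult_left_mono[OF j1, of "2 * s * real j"] by simp
  also have "\<dots> \<le> pi * s * (real j)\<^sup>2"
    using mult_right_mono[OF pi, of "s * (real j)\<^sup>2"] s by (simp add: power2_eq_square mult_ac)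
  finally have 1: "(2 * (s - 1) + real (j - 1) + 1) * G\<^sup>2 \<le> pi * s * (real j)\<^sup>2 * G\<^sup>2"
    by (intro mult_right_mono) auto
  have "1 \<le> s * real j" using mult_mono[OF s j1] s by simp
  then have "2 * 1 \<le> pi * (s * real j)" using pi by (intro mult_mono) auto
  then have 2: "2 * 1 * (2 * (M * G)) \<le> pi * (s * real j) * (2 * (M * G))"
    using G M by (intro mult_right_mono) auto
  have "s * p\<^sup>2 \<le> pi * s * (real j)\<^sup>2 * G\<^sup>2 + 2 * pi * s * real j * M * G"
    using p 1 2 by (simp add: mult_ac)
  also have "\<dots> \<le> s * (2 * pi * (M + real j * G)\<^sup>2)"
  proof -
    have "0 \<le> s * pi * (real j)\<^sup>2 * G\<^sup>2 + 2 * s * pi * M\<^sup>2 + 2 * s * pi * real j * M * G"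
      using s G M by (intro add_nonneg_nonneg mult_nonneg_nonneg) auto
    then show ?thesis by (simp add: power2_eq_square algebra_simps)
  qed
  finally have "p\<^sup>2 \<le> 2 * pi * (M + real j * G)\<^sup>2" using s by simp
  also have "\<dots> = (sqrt (2 * pi) * (M + real j * G))\<^sup>2" by (simp add: power_mult_distrib)
  finally have "\<bar>p\<bar> \<le> \<bar>sqrt (2 * pi) * (M + real j * G)\<bar>" by (simp only: abs_le_square_iff)
  also have "\<dots> = sqrt (2 * pi) * (M + real j * G)" using G M by (intro abs_of_nonneg) simp
  finally show ?thesis .
qed

definition deriv_bound :: "(nat \<Rightarrow> real) \<Rightarrow> nat \<Rightarrow> real" where
  "deriv_bound B n = fact (n - 1) * (\<Sum>j<n. (2 * pi) powr ((real n - real j) / 2) / fact j * B j)"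

lemma deriv_bound_nonneg:
  assumes "\<And>j. B j \<ge> 0"
  shows "deriv_bound B n \<ge> 0"
  unfolding deriv_bound_def using assms by (intro mult_nonneg_nonneg sum_nonneg) auto

lemma deriv_bound_1: "deriv_bound B 1 = sqrt (2 * pi) * B 0"
  by (simp add: deriv_bound_def powr_half_sqrt)

text \<open>Each old term gains a factor n, turning (n-1)! into n!, and half a power of 2 pi. In the
  new term j = n the factorials cancel.\<close>

lemma deriv_bound_Suc:
  assumes "n \<ge> 1"
  shows "deriv_bound B (Suc n) = sqrt (2 * pi) * (B n + real n * deriv_bound B n)"
proof -
  define S where "S = (\<Sum>j<n. (2 * pi) powr ((real n - real j) / 2) / fact j * B j)"
  have "(2 * pi) powr ((real (Suc n) - real j) / 2) = sqrt (2 * pi) * (2 * pi) powr ((real n - real j) / 2)" for j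
  proof -
    have "(real (Suc n) - real j) / 2 = 1 / 2 + (real n - real j) / 2" by (simp add: field_simps)
    then show ?thesis by (simp only: powr_add powr_half_sqrt) (simp add: powr_half_sqrt)
  qed
  then have "(\<Sum>j<Suc n. (2 * pi) powr ((real (Suc n) - real j) / 2) / fact j * B j)
      = (\<Sum>j<Suc n. sqrt (2 * pi) * ((2 * pi) powr ((real n - real j) / 2) / fact j * B j))"
    by (intro sum.cong) simp_all
  also have "\<dots> = sqrt (2 * pi) * (S + B n / fact n)"
    by (simp only: sum_distrib_left[symmetric]) (simp add: S_def)
  finally have "deriv_bound B (Suc n) = sqrt (2 * pi) * (fact n * S + B n)"
    by (simp add: deriv_bound_def distrib_left)
  also have "fact n * S = real n * deriv_bound B n"
    using assms by (simp add: deriv_bound_def S_def fact_reduce[of n])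
  finally show ?thesis by (simp add: add.commute)
qed

text \<open>Each differentiation of \<open>x * f'\<close> adds 1 to the coefficient of the lower
  derivative, hence \<open>2 * (s - 1) + real k\<close>. The step from order m to m + 1 takes k = m
  - 1, and only increments of \<open>q k\<close> enter.\<close>

lemma stein_derivs_bound:
  fixes D q :: "nat \<Rightarrow> real \<Rightarrow> real" and B :: "nat \<Rightarrow> real"
  assumes s: "s \<ge> 1" and B: "\<And>j. B j \<ge> 0"
    and D: "\<And>k x. k < n \<Longrightarrow> x > 0 \<Longrightarrow> (D k has_real_derivative D (Suc k) x) (at x)"
    and rec: "\<And>k x. Suc k < n \<Longrightarrow> x > 0 \<Longrightarrow>
        s * D (Suc (Suc k)) x = x * D (Suc k) x + (2 * (s - 1) + real k) * D k x + q k x"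
    and q: "\<And>k x y. Suc k < n \<Longrightarrow> 0 < x \<Longrightarrow> x \<le> y \<Longrightarrow> \<bar>q k y - q k x\<bar> \<le> B (Suc k) * (y - x)"
    and base: "\<And>x. x > 0 \<Longrightarrow> \<bar>D 1 x\<bar> \<le> sqrt (2 * pi) * B 0"
    and m: "1 \<le> m" "m \<le> n" and x: "x > 0"
  shows "\<bar>D m x\<bar> \<le> deriv_bound B m"
  using m x
proof (induction m arbitrary: x rule: dec_induct)
  case base
  then show ?case using assms(6) by (simp only: deriv_bound_1)
next
  case (step m)
  define k where "k = m - 1"
  have m: "m = Suc k" using step.hyps by (simp add: k_def)
  have "s * (D (Suc (Suc k)) x)\<^sup>2
      \<le> (2 * (s - 1) + real k + 1) * (deriv_bound B m)\<^sup>2 + 4 * B m * deriv_bound B m"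
  proof (rule energy_bound[where F = "D k" and g = "D (Suc k)" and p = "D (Suc (Suc k))" and q = "q k" and x = x])
    show "(D k has_real_derivative D (Suc k) y) (at y)"
      "(D (Suc k) has_real_derivative D (Suc (Suc k)) y) (at y)" if "y > 0" for y
      using D step.prems that m by auto
    show "s * D (Suc (Suc k)) y = y * D (Suc k) y + (2 * (s - 1) + real k) * D k y + q k y" if "y > 0" for y
      using rec step.prems that m by auto
    show "\<bar>q k z - q k y\<bar> \<le> B m * (z - y)" if "0 < y" "y \<le> z" for y z
      using q step.prems that m by auto
    show "\<bar>D (Suc k) y\<bar> \<le> deriv_bound B m" if "y > 0" for y
      using step.IH[of y] step.prems that m by auto
  qed (use s B step.prems in auto)
  then have "\<bar>D (Suc (Suc k)) x\<bar> \<le> sqrt (2 * pi) * (B m + real m * deriv_bound B m)"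
    using s B m by (intro deriv_bound_step) (auto intro: deriv_bound_nonneg)
  then show ?case using deriv_bound_Suc[of m B] m by simp
qed

text \<open>The derivatives of a solution, obtained from its first two by differentiating the Stein equation.\<close>

fun stein_derivs :: "real \<Rightarrow> (nat \<Rightarrow> real \<Rightarrow> real) \<Rightarrow> (real \<Rightarrow> real) \<Rightarrow> (real \<Rightarrow> real) \<Rightarrow> nat \<Rightarrow> real \<Rightarrow> real" where
  "stein_derivs s q f f1 0 = f"
| "stein_derivs s q f f1 (Suc 0) = f1"
| "stein_derivs s q f f1 (Suc (Suc k)) = (\<lambda>x. (x * stein_derivs s q f f1 (Suc k) x
      + (2 * (s - 1) + real k) * stein_derivs s q f f1 k x + q k x) / s)"

text \<open>Differentiating the formula for index j + 2 gives the one for j + 3, the derivative of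
  the factor x raising the coefficient by 1. The first two indices are given; \<open>f1\<close>
  needs a derivative only for n > 1, since for n = 1 the right-hand side may be
  discontinuous.\<close>

lemma DERIV_stein_derivs:
  assumes f: "\<And>x. x > 0 \<Longrightarrow> (f has_real_derivative f1 x) (at x)"
    and f1: "\<And>x. Suc 0 < n \<Longrightarrow> x > 0 \<Longrightarrow> (f1 has_real_derivative stein_derivs s q f f1 2 x) (at x)"
    and q: "\<And>k x. Suc (Suc k) < n \<Longrightarrow> x > 0 \<Longrightarrow> (q k has_real_derivative q (Suc k) x) (at x)"
    and "k < n" "x > 0"
  shows "(stein_derivs s q f f1 k has_real_derivative stein_derivs s q f f1 (Suc k) x) (at x)"
  using assms(4)
proof (induction k rule: less_induct)
  case (less k)
  define D where "D = stein_derivs s q f f1"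
  consider "k = 0" | "k = Suc 0" | j where "k = Suc (Suc j)" by (metis not0_implies_Suc)
  then show ?case
  proof cases
    case 3
    have 1: "(D j has_real_derivative D (Suc j) x) (at x)"
      and 2: "(D (Suc j) has_real_derivative D (Suc (Suc j)) x) (at x)"
      unfolding D_def using less.IH[of j] less.IH[of "Suc j"] less.prems 3 by simp_all
    have 3: "(q j has_real_derivative q (Suc j) x) (at x)" using q less.prems 3 \<open>x > 0\<close> by simp
    have "((\<lambda>x. (x * D (Suc j) x + (2 * (s - 1) + real j) * D j x + q j x) / s) has_real_derivative
        ((1 * D (Suc j) x + D (Suc (Suc j)) x * x) + (2 * (s - 1) + real j) * D (Suc j) x + q (Suc j) x) / s) (at x)"
      by (intro DERIV_cdivide DERIV_add DERIV_mult DERIV_cmult DERIV_ident 1 2 3)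
    moreover have "(1 * D (Suc j) x + D (Suc (Suc j)) x * x) + (2 * (s - 1) + real j) * D (Suc j) x + q (Suc j) x
        = x * D (Suc (Suc j)) x + (2 * (s - 1) + real (Suc j)) * D (Suc j) x + q (Suc j) x"
      by (simp add: algebra_simps)
    ultimately show ?thesis unfolding \<open>k = Suc (Suc j)\<close> stein_derivs.simps(3) D_def by (simp only:)
  qed (use f f1 less \<open>x > 0\<close> in \<open>auto simp: numeral_2_eq_2\<close>)
qed

section \<open>Total mass and expectation under the law of Z\<close>

lemma PRR_normalisation:
  assumes M: "prob_space M"
    and Z: "distributed M (restrict_space lborel Rpos) Z (\<lambda>x. ennreal (k x))"
    and eq: "\<And>x. x > 0 \<Longrightarrow> k x = d x"
  shows "(\<integral>\<^sup>+x. ennreal (indicator {0..} x * d x) \<partial>lborel) = 1"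
proof -
  interpret prob_space M by (rule M)
  \<comment> \<open>The mass is read off from the law of \<open>Z\<close>, so no integral of U is
    computed. The point 0, where \<open>k\<close> and \<open>d\<close> might differ, is a null
    set.\<close>
  have "(\<integral>\<^sup>+x. ennreal (indicator {0..} x * d x) \<partial>lborel) = (\<integral>\<^sup>+x. ennreal (k x) * indicator Rpos x \<partial>lborel)"
    by (rule nn_integral_cong_AE)
      (use AE_lborel_singleton[of "0::real"] in \<open>eventually_elim, auto simp: indicator_def eq\<close>)
  also have "\<dots> = (\<integral>\<^sup>+x. ennreal (k x) * 1 \<partial>restrict_space lborel Rpos)"
    by (subst nn_integral_restrict_space) auto
  also have "\<dots> = (\<integral>\<^sup>+x. 1 \<partial>M)" by (rule distributed_nn_integral[OF Z]) auto
  also have "\<dots> = 1" by (simp add: emeasure_space_1)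
  finally show ?thesis .
qed

text \<open>Unlike the normalisation, this needs a nonnegative density; that sign is itself a
  consequence of the normalisation, by way of \<open>dens_pos\<close>.\<close>

lemma PRR_expectation:
  fixes h d k :: "real \<Rightarrow> real"
  assumes M: "prob_space M"
    and Z: "distributed M (restrict_space lborel Rpos) Z (\<lambda>x. ennreal (k x))"
    and eq: "\<And>x. x > 0 \<Longrightarrow> k x = d x"
    and pos: "\<And>x. x > 0 \<Longrightarrow> 0 \<le> d x"
    and h: "h \<in> borel_measurable (restrict_space borel Rpos)"
    and m: "\<And>x. x > 0 \<Longrightarrow> \<bar>h x\<bar> \<le> m"
  shows "has_bochner_integral lborel (\<lambda>x. indicator Rpos x * (d x * h x)) (prob_space.expectation M (\<lambda>\<omega>. h (Z \<omega>)))"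
    and "\<bar>prob_space.expectation M (\<lambda>\<omega>. h (Z \<omega>))\<bar> \<le> m"
proof -
  interpret prob_space M by (rule M)
  have h': "h \<in> borel_measurable (restrict_space lborel Rpos)"
    using h by (simp cong: measurable_cong_sets add: sets_restrict_space)
  have k: "0 \<le> k x" if "x \<in> space (restrict_space lborel Rpos)" for x
    using that pos[of x] eq[of x] by (simp add: space_restrict_space)
  have Zm: "Z \<in> measurable M (restrict_space lborel Rpos)"
    using Z by (rule distributed_measurable)
  have Zpos: "Z \<omega> > 0" if "\<omega> \<in> space M" for \<omega>
    using measurable_space[OF Zm that] by (simp add: space_restrict_space)
  have int: "integrable M (\<lambda>\<omega>. h (Z \<omega>))"
  proof (rule integrable_const_bound)
    show "AE \<omega> in M. norm (h (Z \<omega>)) \<le> m" using m Zpos by (auto intro!: AE_I2)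
    show "(\<lambda>\<omega>. h (Z \<omega>)) \<in> borel_measurable M" using measurable_compose[OF Zm h'] .
  qed
  have le: "expectation (\<lambda>\<omega>. h (Z \<omega>)) \<le> m"
    using m Zpos by (intro integral_le_const int) (auto intro!: AE_I2 simp: abs_le_iff)
  have "expectation (\<lambda>\<omega>. h (Z \<omega>)) \<ge> - m"
    using m Zpos by (intro integral_ge_const int) (auto intro!: AE_I2 simp: abs_le_iff minus_le_iff)
  with le show "\<bar>expectation (\<lambda>\<omega>. h (Z \<omega>))\<bar> \<le> m" by simp
  have "has_bochner_integral (restrict_space lborel Rpos) (\<lambda>x. k x * h x) (expectation (\<lambda>\<omega>. h (Z \<omega>)))"
    using distributed_integral[OF Z h' k] distributed_integrable[OF Z h' k] int
    by (simp add: has_bochner_integral_iff)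
  then have "has_bochner_integral lborel (\<lambda>x. indicator Rpos x *\<^sub>R (k x * h x)) (expectation (\<lambda>\<omega>. h (Z \<omega>)))"
    by (simp add: has_bochner_integral_iff integrable_restrict_space integral_restrict_space)
  also have "(\<lambda>x. indicator Rpos x *\<^sub>R (k x * h x)) = (\<lambda>x. indicator Rpos x * (d x * h x))"
    by (auto simp: indicator_def eq)
  finally show "has_bochner_integral lborel (\<lambda>x. indicator Rpos x * (d x * h x)) (expectation (\<lambda>\<omega>. h (Z \<omega>)))" .
qed

section \<open>Identification with \<open>stein_sol\<close> and assembly\<close>

context prr_stein
begin

lemma integral_Ioo_eq_I: "(LBINT t:{0<..<y}. g t * dens t) = I y"
proof -
  have "set_integrable lborel {0<..<y} (\<lambda>t. g t * dens t)"
    by (rule set_integrable_subset[OF set_integrable_g[of y]]) auto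
  then show ?thesis
    by (simp add: set_borel_integral_eq_integral I_def integral_open_interval_real)
qed

lemma integral_Ioo_eq_u: "(LBINT y:{0<..<x}. I y / (W y * dens y)) = u x"
proof -
  have "set_integrable lborel {0<..<x} (\<lambda>y. I y / (W y * dens y))"
    by (rule set_integrable_subset[OF borel_integrable_atLeastAtMost'[OF continuous_on_u_integrand[of x]]]) auto
  then show ?thesis
    by (simp add: set_borel_integral_eq_integral u_def integral_open_interval_real)
qed

text \<open>The integrals over open intervals see positive points only, so agreement there is enough
  to replace V, the density and the right-hand side.\<close>

lemma stein_sol_eq:
  assumes V: "\<And>x. x > 0 \<Longrightarrow> PRR_V s x = W x"
    and d: "\<And>x. x > 0 \<Longrightarrow> PRR_density s x = dens x"
    and g: "\<And>x. x > 0 \<Longrightarrow> h' x = g x"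
    and x: "x > 0"
  shows "stein_sol s h' x = sol x"
proof -
  have 1: "(LBINT t:{0<..<y}. h' t * PRR_density s t) = I y" for y
    unfolding integral_Ioo_eq_I[symmetric] by (intro set_lebesgue_integral_cong) (auto simp: d g)
  have "(LBINT y:{0<..<x}. 1 / (PRR_V s y * PRR_density s y) * I y) = u x"
    unfolding integral_Ioo_eq_u[symmetric] by (intro set_lebesgue_integral_cong) (auto simp: d V)
  then show ?thesis unfolding stein_sol_def 1 by (simp add: V[OF x] sol_def)
qed

end

theorem mainTheorem9:
  fixes s :: real and n :: nat and h :: "real \<Rightarrow> real"
    and M :: "'a measure" and Z :: "'a \<Rightarrow> real"
    and h' f :: "real \<Rightarrow> real"
  assumes "s \<ge> 1" and "n \<ge> 1"
    and "prob_space M"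
    and "distributed M (restrict_space lborel Rpos) Z (\<lambda>x. ennreal (PRR_density s x))"
    and "h \<in> borel_measurable (restrict_space borel Rpos)"
    and "Cb (n - 1) h"
    and "h' = (\<lambda>x. h x - prob_space.expectation M (\<lambda>\<omega>. h (Z \<omega>)))"
    and "f = stein_sol s h'"
  shows "(\<forall>x>0. isCont h x \<longrightarrow>
            nderiv_exists 2 f x \<and>
            s * (deriv ^^ 2) f x - x * deriv f x - 2 * (s - 1) * f x = h' x)
       \<and> (\<forall>x>0. nderiv_exists n f x)
       \<and> deriv_norm n f \<le>
           ennreal (fact (n - 1)) *
             (\<Sum>j<n. ennreal ((2 * pi) powr ((real n - real j) / 2) / fact j) * deriv_norm j h)"
proof -
  note s = assms(1) and n = assms(2) and Z = assms(4) and h_meas = assms(5) and Cb = assms(6)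
  obtain W W' where W:
    "\<And>x. x \<ge> 0 \<Longrightarrow> PRR_V s x = W x"
    "\<And>x. (W has_real_derivative W' x) (at x)"
    "\<And>x. (W' has_real_derivative ((x * W' x + 2 * (s - 1) * W x) / s)) (at x)"
    "W 0 > 0"
    "Gamma s * sqrt (2 / (s * pi)) * s * W' 0 = - (2 * (s - 1))"
    using PRR_V_ode[OF s] by blast
  define A where "A = Gamma s * sqrt (2 / (s * pi))"
  have A: "A > 0" using s by (auto simp: A_def Gamma_real_pos)
  have density: "PRR_density s x = A * exp (- (x\<^sup>2 / (2 * s))) * W x" if "x > 0" for x
    using W(1)[of x] that by (simp add: PRR_density_def A_def PRR_V_def)
  interpret prr s "2 * (s - 1)" A W W'
    using s A W(2-5) PRR_normalisation[OF assms(3) Z density]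
    by unfold_locales (auto simp: A_def)
  have density: "PRR_density s x = dens x" if "x > 0" for x
    using density[OF that] by (simp add: dens_def)
  define B where "B j = enn2real (deriv_norm j h)" for j
  have B: "B j \<ge> 0" for j by (simp add: B_def)
  have fin: "deriv_norm j h < \<infinity>" if "j < n" for j using Cb that n by (auto simp: Cb_def)
  have h_le: "\<bar>h x\<bar> \<le> B 0" if "x > 0" for x
    using abs_nderiv_le_deriv_norm[OF fin, of 0 x] that n by (simp add: B_def)
  define \<mu> where "\<mu> = prob_space.expectation M (\<lambda>\<omega>. h (Z \<omega>))"
  have h': "h' x = h x - \<mu>" for x using assms(7) by (simp add: \<mu>_def)
  note E = PRR_expectation[OF assms(3) Z density _ h_meas h_le, folded \<mu>_def]
  have \<mu>: "has_bochner_integral lborel (\<lambda>x. indicator Rpos x * (dens x * h x)) \<mu>" "\<bar>\<mu>\<bar> \<le> B 0"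
    using E by (simp_all add: less_imp_le[OF dens_pos])
  \<comment> \<open>Measurability and bounds of \<open>h\<close> are known only on the half-line;
    extension by 0 makes them global, as the locale asks.\<close>
  define g where "g x = indicator Rpos x * h' x" for x
  have g_eq: "h' x = g x" if "x > 0" for x using that by (simp add: g_def)
  have g_meas [measurable]: "g \<in> borel_measurable borel"
  proof -
    have "(\<lambda>x. indicator Rpos x *\<^sub>R h x) \<in> borel_measurable borel"
      using h_meas by (subst (asm) borel_measurable_restrict_space_iff) auto
    then have "(\<lambda>x. indicator Rpos x *\<^sub>R h x - indicator Rpos x * \<mu>) \<in> borel_measurable borel"
      by measurable
    then show ?thesis
      by (simp add: g_def[abs_def] h' right_diff_distrib)
  qed
  interpret prr_stein s "2 * (s - 1)" A W W' g "B 0 + \<mu>" "B 0 - \<mu>"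
  proof
    show "g \<in> borel_measurable borel" by (rule g_meas)
    show "- (B 0 + \<mu>) \<le> g x" "g x \<le> B 0 - \<mu>" for x
      using h_le[of x] \<mu>(2) by (auto simp: g_def h' indicator_def)
    show "0 \<le> B 0 + \<mu>" "0 \<le> B 0 - \<mu>" using \<mu>(2) by auto
    have diff: "has_bochner_integral lborel
        (\<lambda>x. indicator Rpos x * (dens x * h x) - \<mu> * (indicator {0..} x * dens x)) (\<mu> - \<mu> * 1)"
      by (intro has_bochner_integral_diff has_bochner_integral_mult_right \<mu>(1) dens_integral)
    have "(LBINT x. indicator {0..} x * (g x * dens x))
        = (LBINT x. indicator Rpos x * (dens x * h x) - \<mu> * (indicator {0..} x * dens x))"
    proof (rule integral_cong_AE)
      show "AE x in lborel. indicator {0..} x * (g x * dens x)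
          = indicator Rpos x * (dens x * h x) - \<mu> * (indicator {0..} x * dens x)"
        using AE_lborel_singleton[of "0::real"]
        by eventually_elim (auto simp: g_def h' indicator_def algebra_simps)
    qed (use borel_measurable_has_bochner_integral[OF diff] in auto)
    also have "\<dots> = \<mu> - \<mu> * 1" by (rule has_bochner_integral_integral_eq[OF diff])
    finally show "(LBINT x. indicator {0..} x * (g x * dens x)) = 0" by simp
  qed
  have f: "f x = sol x" if "x > 0" for x
    unfolding assms(8) using W(1) density g_eq that by (intro stein_sol_eq) auto
  have isCont_g: "isCont g x" if "x > 0" "isCont h x" for x
  proof -
    have "isCont h' x" using that by (simp add: h'[abs_def])
    moreover have "\<forall>\<^sub>F y in nhds x. h' y = g y"
      using eventually_nhds_in_open[of Rpos x] that by (auto elim!: eventually_mono simp: g_eq)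
    ultimately show ?thesis using isCont_cong by blast
  qed
  \<comment> \<open>Only \<open>q 0\<close> carries the constant \<open>\<mu>\<close>, which
    disappears from increments and derivatives.\<close>
  define q where "q k = (if k = 0 then h' else (deriv ^^ k) h)" for k
  have q_diff: "q k y - q k x = (deriv ^^ k) h y - (deriv ^^ k) h x" for k x y
    by (simp add: q_def h')
  define D where "D = stein_derivs s q sol sol'"
  have D_0: "D 0 = sol" and D_1: "D (Suc 0) = sol'" by (simp_all add: D_def)
  have D_2: "D 2 x = (x * sol' x + 2 * (s - 1) * sol x + h' x) / s" for x
    by (simp add: D_def numeral_2_eq_2 q_def)
  have D_sol'2: "(sol' has_real_derivative D 2 x) (at x)" if "x > 0" "isCont h x" for x
    using D_sol'[OF that(1) isCont_g[OF that]] g_eq[OF that(1)] by (simp add: D_2)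
  have lip: "\<bar>q k y - q k x\<bar> \<le> B (Suc k) * (y - x)" if "Suc k < n" "0 < x" "x \<le> y" for k x y
    unfolding q_diff B_def using that by (intro Cb_nderiv_lipschitz[OF Cb]) auto
  have DD: "(D k has_real_derivative D (Suc k) x) (at x)" if "k < n" "x > 0" for k x
    unfolding D_def
  proof (rule DERIV_stein_derivs[OF _ _ _ that])
    fix x :: real assume x: "x > 0"
    show "(sol has_real_derivative sol' x) (at x)" by (rule D_sol[OF x])
    show "(sol' has_real_derivative stein_derivs s q sol sol' 2 x) (at x)" if "Suc 0 < n"
    proof -
      \<comment> \<open>For n >= 2 the function \<open>h\<close> is Lipschitz, so every positive
        point is a point of continuity.\<close>
      have "continuous_on Rpos h"
        using lip[of 0] that B[of 1] by (intro continuous_on_Rpos_of_increments[of "B 1"]) (auto simp: q_def h')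
      then have "isCont h x" using x by (simp add: continuous_on_eq_continuous_at)
      then show ?thesis using D_sol'2[OF x] by (simp add: D_def)
    qed
    show "(q k has_real_derivative q (Suc k) x) (at x)" if "Suc (Suc k) < n" for k
    proof -
      \<comment> \<open>Membership in the class of order n - 1 gives n - 2 derivatives everywhere,
        and k + 1 <= n - 2 here.\<close>
      have "nderiv_exists (n - 1 - 1) h x" using Cb that x unfolding Cb_def by simp
      then have "nderiv_exists (Suc k) h x" by (rule nderiv_exists_mono) (use that in simp)
      then have *: "((deriv ^^ k) h has_real_derivative (deriv ^^ Suc k) h x) (at x)"
        by (rule nderiv_exists_DERIV)
      show ?thesis
      proof (cases "k = 0")
        case True
        then have "(h has_real_derivative deriv h x) (at x)" using * by simp
        then have "((\<lambda>x. h x - \<mu>) has_real_derivative deriv h x - 0) (at x)"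
          by (intro DERIV_diff DERIV_const)
        then show ?thesis using True by (simp add: q_def h'[abs_def])
      qed (use * in \<open>simp add: q_def\<close>)
    qed
  qed
  have chain: "nderiv_exists k f x \<and> (deriv ^^ k) f x = D k x" if "k \<le> n" "x > 0" for k x
    using nderiv_chain[of f D n k x] f DD that by (simp add: D_0)
  have bound: "\<bar>D n x\<bar> \<le> deriv_bound B n" if "x > 0" for x
  proof (rule stein_derivs_bound[where D = D and q = q and B = B and m = n and n = n, OF s B DD _ lip _ n order_refl that])
    show "s * D (Suc (Suc k)) x = x * D (Suc k) x + (2 * (s - 1) + real k) * D k x + q k x" for k x
      using s by (simp add: D_def)
    show "\<bar>D 1 x\<bar> \<le> sqrt (2 * pi) * B 0" if "x > 0" for x
    proof -
      \<comment> \<open>The two bounds add up to \<open>2 * B 0\<close>, and 2 sqrt(pi/(2s)) =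
        sqrt(2 pi/s) is at most sqrt(2 pi) as s >= 1.\<close>
      have "\<bar>sol' x\<bar> \<le> (B 0 + \<mu> + (B 0 - \<mu>)) * sqrt (pi / (2 * s))"
        using that by (intro sol'_bound) simp
      also have "\<dots> = B 0 * sqrt (2 * pi / s)"
      proof -
        have "sqrt (2 * pi / s) = sqrt (2\<^sup>2 * (pi / (2 * s)))" by (simp add: power2_eq_square)
        then show ?thesis by (simp only: real_sqrt_mult real_sqrt_abs) simp
      qed
      also have "\<dots> \<le> B 0 * sqrt (2 * pi)"
        using s B by (intro mult_left_mono) (auto simp: divide_le_eq mult_le_cancel_left1)
      finally show ?thesis by (simp add: D_1 mult.commute)
    qed
  qed
  \<comment> \<open>For n = 1 \<open>chain\<close> ends with the first derivative, so the second one
    is taken from \<open>D_sol'\<close> at points where \<open>h\<close> is continuous.\<close>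
  have stein: "nderiv_exists 2 f x \<and> s * (deriv ^^ 2) f x - x * deriv f x - 2 * (s - 1) * f x = h' x"
    if x: "x > 0" "isCont h x" for x
  proof -
    have "((deriv ^^ 1) f has_real_derivative D 2 x) (at x)"
    proof (rule has_field_derivative_transform_within_open[OF D_sol'2[OF x] open_greaterThan[of 0]])
      show "sol' y = (deriv ^^ 1) f y" if "y \<in> {0<..}" for y
        using chain[of 1 y] n that by (simp add: D_1)
    qed (use x in simp)
    moreover from this have "nderiv_exists (Suc 1) f x"
      using chain[of 1] n x(1) by (intro nderiv_exists_SucI) (auto simp: real_differentiable_def)
    moreover have "deriv f x = sol' x" using chain[of 1 x] n x(1) by (simp add: D_1)
    ultimately show ?thesis
      using s f[OF x(1)] by (simp add: numeral_2_eq_2 DERIV_imp_deriv) (simp add: D_2[unfolded numeral_2_eq_2])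
  qed
  have "deriv_norm n f \<le> ennreal (deriv_bound B n)"
    unfolding deriv_norm_def using chain[of n] bound by (intro SUP_least) (auto intro!: ennreal_leI)
  also have "ennreal (deriv_bound B n) = ennreal (fact (n - 1)) *
      (\<Sum>j<n. ennreal ((2 * pi) powr ((real n - real j) / 2) / fact j) * deriv_norm j h)"
  proof -
    have norm_eq: "deriv_norm j h = ennreal (B j)" if "j < n" for j
      using fin[OF that] by (simp add: B_def ennreal_enn2real)
    have "(\<Sum>j<n. ennreal ((2 * pi) powr ((real n - real j) / 2) / fact j) * deriv_norm j h)
        = (\<Sum>j<n. ennreal ((2 * pi) powr ((real n - real j) / 2) / fact j * B j))"
      using B by (intro sum.cong) (simp_all add: norm_eq ennreal_mult[symmetric] del: times_divide_eq_left)
    also have "\<dots> = ennreal (\<Sum>j<n. (2 * pi) powr ((real n - real j) / 2) / fact j * B j)"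
      using B by (intro sum_ennreal) simp
    finally show ?thesis
      using B by (simp only: deriv_bound_def) (intro ennreal_mult sum_nonneg, auto)
  qed
  finally show ?thesis using stein chain[of n] by blast
qed

end
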